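(* Let $0<q<1$, let $\alpha>0$ be real, let $0<a<x<1$, and let $b,z,t,r,u,s$ be parameters (complex numbers). If $\max\{|at|,|az|,|aru|\}<1$, then $$ I_{q,a}^{\alpha}\left\{\frac{(bxz,xt,xru;q)_\infty}{(xs,xz,xu;q)_\infty}\right\} =\frac{(1-q)^{\alpha}(abz,at,aru;q)_\infty}{(as,az,au;q)_\infty}\sum_{k=0}^{\infty}\frac{x^{\alpha+k}(a/x;q)_{\alpha+k}}{a^{k}(q;q)_{\alpha+k}}\;{}_4\phi_3\left[\begin{matrix}q^{-k},\,as,\,az,\,au\\ abz,\,at,\,aru\end{matrix};q,q\right], $$ where the operator $I_{q,a}^{\alpha}$ acts on the displayed expression regarded as a function of $x$, and the result is evaluated at $x$.
   Context: Notation ($0<q<1$). $(c;q)_0=1$, $(c;q)_n=\prod_{k=0}^{n-1}(1-cq^k)$, $(c;q)_\infty=\prod_{k=0}^{\infty}(1-cq^k)$; for real $\nu$, $(c;q)_\nu=(c;q)_\infty/(cq^{\nu};q)_\infty$ (the standard extension). For $n$ a nonnegative integer or $\infty$, $(c_1,\dots,c_m;q)_n=(c_1;q)_n\cdots(c_m;q)_n$. Basic hypergeometric series: $${}_r\phi_s\left[\begin{matrix}a_1,\dots,a_r\\ b_1,\dots,b_s\end{matrix};q,w\right]=\sum_{n=0}^\infty\frac{(a_1,\dots,a_r;q)_n}{(q,b_1,\dots,b_s;q)_n}\left[(-1)^nq^{n(n-1)/2}\right]^{1+s-r}w^n ;$$ in particular, with $q^{-k}$ as an upper parameter ($k$ a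 nonnegative integer) the series terminates at $n=k$. $q$-gamma function: $\Gamma_q(y)=\frac{(q;q)_\infty}{(q^y;q)_\infty}(1-q)^{1-y}$ for real $y\notin\{0,-1,-2,\dots\}$. Thomae--Jackson $q$-integral: $\int_{a}^{b}f(y)\,d_qy=(1-q)\sum_{n=0}^\infty\left[b f(bq^n)-a f(aq^n)\right]q^n$. Generalized Riemann--Liouville fractional $q$-integral operator, for real $\alpha>0$: $$\left(I_{q,a}^{\alpha}f\right)(x)=\frac{x^{\alpha-1}}{\Gamma_q(\alpha)}\int_a^x (qy/x;q)_{\alpha-1}\,f(y)\,d_qy .$$
   Formalization: The series over k can diverge (e.g. b=z=t=r=u=0, |xs|≥1), so the identity is stated whenever it converges, and convergence is proved if |xs|,|xz|,|xu|<1; also (xs,xz,xu;q)_∞ and (as,au;q)_∞ have no zero factor and abz is not q^{-n}. *)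

theory Defs
  imports "HOL-Analysis.Analysis"
begin

text \<open>
  The base \<open>q\<close> is always a real number in the open unit interval; parameters live in a real normed
  field, so that the same symbols serve real arguments (as in the \<open>q\<close>-gamma function and in the
  kernel of the fractional integral) and complex ones.
\<close>

definition qpoch :: "'a::real_normed_field \<Rightarrow> real \<Rightarrow> nat \<Rightarrow> 'a" where
  "qpoch c q n = (\<Prod>k<n. 1 - c * of_real q ^ k)"

definition qpoch_inf :: "'a::real_normed_field \<Rightarrow> real \<Rightarrow> 'a" where
  "qpoch_inf c q = (\<Prod>k. 1 - c * of_real q ^ k)"

definition qpoch_real :: "'a::real_normed_field \<Rightarrow> real \<Rightarrow> real \<Rightarrow> 'a" where
  "qpoch_real c q \<nu> = qpoch_inf c q / qpoch_inf (c * of_real (q powr \<nu>)) q"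

definition qpochs :: "'a::real_normed_field list \<Rightarrow> real \<Rightarrow> nat \<Rightarrow> 'a" where
  "qpochs cs q n = (\<Prod>c\<leftarrow>cs. qpoch c q n)"

definition qpochs_inf :: "'a::real_normed_field list \<Rightarrow> real \<Rightarrow> 'a" where
  "qpochs_inf cs q = (\<Prod>c\<leftarrow>cs. qpoch_inf c q)"

text \<open>
  The basic hypergeometric series, with \<open>r\<close> and \<open>s\<close> the lengths of the two parameter lists; the
  exponent \<open>1 + s - r\<close> is an integer and may be negative. The implicit lower parameter \<open>q\<close> is
  added to the list \<open>bs\<close>.
\<close>

definition qhyp :: "complex list \<Rightarrow> complex list \<Rightarrow> real \<Rightarrow> complex \<Rightarrow> complex" where
  "qhyp as bs q w =
     (\<Sum>n. qpochs as q n / qpochs (of_real q # bs) q n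
        * ((-1) ^ n * of_real q ^ (n * (n - 1) div 2)) powi (1 + int (length bs) - int (length as))
        * w ^ n)"

definition qGamma :: "real \<Rightarrow> real \<Rightarrow> real" where
  "qGamma q y = qpoch_inf q q / qpoch_inf (q powr y) q * (1 - q) powr (1 - y)"

definition qintegral :: "real \<Rightarrow> real \<Rightarrow> real \<Rightarrow> (real \<Rightarrow> complex) \<Rightarrow> complex" where
  "qintegral q a b f =
     of_real (1 - q) *
     (\<Sum>n. (of_real b * f (b * q ^ n) - of_real a * f (a * q ^ n)) * of_real q ^ n)"

definition frac_qintegral :: "real \<Rightarrow> real \<Rightarrow> real \<Rightarrow> (real \<Rightarrow> complex) \<Rightarrow> real \<Rightarrow> complex" where
  "frac_qintegral q a \<alpha> f x =
     of_real (x powr (\<alpha> - 1) / qGamma q \<alpha>) *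
     qintegral q a x (\<lambda>y. of_real (qpoch_real (q * y / x) q (\<alpha> - 1)) * f y)"

end

theory Submission
  imports Defs "HOL-Complex_Analysis.Complex_Analysis"
begin

text \<open>
  Write the function under the operator as \<open>f = H / G\<close> with \<open>G, H\<close> entire. Up to the factor
  \<open>f a\<close>, the terminating \<open>4\<phi>3\<close> is the sum \<open>\<Sum>j. (q^-k; q)_j / (q; q)_j * q^j * f (a * q^j)\<close>, a \<open>k\<close>-th
  \<open>q\<close>-difference of \<open>f\<close> at \<open>a\<close>, so the right-hand side is the termwise fractional \<open>q\<close>-integral of
  the Newton interpolation series of \<open>f\<close> at the nodes \<open>a, a * q, a * q^2, \<dots>\<close>. If the series on
  the right converges at \<open>x\<close>, then the Newton series converges locally uniformly on \<open>|y| < x\<close> to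
  some \<open>N\<close>; as \<open>G * N\<close> and \<open>H\<close> agree at the nodes, which accumulate at \<open>0\<close>, they agree on the
  disc, whether or not \<open>f\<close> was known to be regular there. An Abel argument covers the boundary
  point \<open>x\<close>.
\<close>

section \<open>The $q$-shifted factorials\<close>

context
  fixes q :: real
  assumes q: "0 < q" "q < 1"
begin

section \<open>Convergence, splitting and non-vanishing of the products\<close>

lemma convergent_prod_qpoch:
  fixes c :: "'a :: {real_normed_field, banach}"
  shows "convergent_prod (\<lambda>k. 1 - c * of_real q ^ k)"
proof -
  have "summable (\<lambda>k. norm c * q ^ k)"
    using q by (intro summable_mult summable_geometric) auto
  then have "summable (\<lambda>k. norm ((1 - c * of_real q ^ k) - 1))"
    using q by (simp add: norm_mult norm_power)
  then show ?thesis
    by (intro abs_convergent_prod_imp_convergent_prod)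
       (simp add: abs_convergent_prod_conv_summable)
qed

lemma qpoch_LIMSEQ:
  fixes c :: "'a :: {real_normed_field, banach}"
  shows "(\<lambda>n. qpoch c q n) \<longlonglongrightarrow> qpoch_inf c q"
  using convergent_prod_LIMSEQ[OF convergent_prod_qpoch[of c]]
  unfolding qpoch_def qpoch_inf_def
  \<comment> \<open>The limit law for convergent products runs over \<open>{..n}\<close>; an index
    shift gives the products over \<open>{..<n}\<close> used in \<open>qpoch\<close>.\<close>
  by (subst (asm) lessThan_Suc_atMost[symmetric], subst (asm) filterlim_sequentially_Suc)

lemma qpoch_of_real: "qpoch (of_real c :: 'a :: real_normed_field) q n = of_real (qpoch c q n)"
  by (simp add: qpoch_def)

lemma qpoch_inf_nonzero:
  fixes c :: "'a :: {real_normed_field, banach}"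
  assumes "\<And>n. c * of_real q ^ n \<noteq> 1"
  shows "qpoch_inf c q \<noteq> 0"
  unfolding qpoch_inf_def using assms
  by (intro prodinf_nonzero convergent_prod_qpoch) (metis eq_iff_diff_eq_0)

lemma qpoch_add:
  fixes c :: "'a :: real_normed_field"
  shows "qpoch c q (n + m) = qpoch c q n * qpoch (c * of_real q ^ n) q m"
  by (induction m) (simp_all add: qpoch_def power_add mult.assoc)

text \<open>Both sides are the limit of \<open>qpoch c q (n + m)\<close> as \<open>m\<close> tends
  to infinity.\<close>

lemma qpoch_inf_split:
  fixes c :: "'a :: {real_normed_field, banach}"
  shows "qpoch_inf c q = qpoch c q n * qpoch_inf (c * of_real q ^ n) q"
proof -
  have "(\<lambda>m. qpoch c q (n + m)) \<longlonglongrightarrow> qpoch_inf c q"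
    using LIMSEQ_ignore_initial_segment[OF qpoch_LIMSEQ[of c], of n] by (simp add: add.commute)
  moreover have "(\<lambda>m. qpoch c q (n + m)) \<longlonglongrightarrow> qpoch c q n * qpoch_inf (c * of_real q ^ n) q"
    unfolding qpoch_add by (intro tendsto_intros qpoch_LIMSEQ)
  ultimately show ?thesis by (rule LIMSEQ_unique)
qed

lemma qpoch_inf_head:
  fixes c :: "'a :: {real_normed_field, banach}"
  shows "qpoch_inf c q = (1 - c) * qpoch_inf (c * of_real q) q"
  using qpoch_inf_split[of c 1] by (simp add: qpoch_def)

lemma qpoch_nonzero:
  fixes c :: "'a :: real_normed_field"
  assumes "\<And>n. c * of_real q ^ n \<noteq> 1"
  shows "qpoch c q n \<noteq> 0"
  using assms by (auto simp: qpoch_def)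

lemma norm_less_1_mult_power_neq_1:
  fixes c :: "'a :: real_normed_field"
  assumes "norm c < 1"
  shows "c * of_real q ^ n \<noteq> 1"
proof
  assume "c * of_real q ^ n = 1"
  then have "norm (c * of_real q ^ n) = 1" by simp
  then have "norm c * q ^ n = 1" using q by (simp add: norm_mult norm_power)
  moreover have "norm c * q ^ n \<le> norm c * 1"
    using q by (intro mult_left_mono power_le_one) auto
  ultimately show False using assms by simp
qed

section \<open>Monotonicity and positivity for real arguments in the unit interval\<close>

lemma qpoch_real_mono:
  fixes c d :: real
  assumes "0 \<le> c" "c \<le> d" "d \<le> 1"
  shows "0 \<le> qpoch d q n" "qpoch d q n \<le> qpoch c q n" "qpoch c q n \<le> 1"
proof -
  have 1: "0 \<le> 1 - e * q ^ k" if "0 \<le> e" "e \<le> 1" for e k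
    using q that by (simp add: mult_le_one power_le_one)
  show "0 \<le> qpoch d q n"
    unfolding qpoch_def using 1[of d] assms by (intro prod_nonneg) auto
  show "qpoch d q n \<le> qpoch c q n"
    unfolding qpoch_def using 1[of d] assms q
    by (intro prod_mono) (auto intro!: mult_right_mono)
  show "qpoch c q n \<le> 1"
    unfolding qpoch_def using 1[of c] assms q by (intro prod_le_1) auto
qed

lemma qpoch_inf_real_mono:
  fixes c d :: real
  assumes "0 \<le> c" "c \<le> d" "d \<le> 1"
  shows "0 \<le> qpoch_inf d q" "qpoch_inf d q \<le> qpoch_inf c q" "qpoch_inf c q \<le> 1"
        "qpoch_inf c q \<le> qpoch c q n"
proof -
  show "0 \<le> qpoch_inf d q"
    by (rule LIMSEQ_le_const[OF qpoch_LIMSEQ]) (use qpoch_real_mono[OF assms] in auto)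
  show "qpoch_inf d q \<le> qpoch_inf c q"
    by (rule LIMSEQ_le[OF qpoch_LIMSEQ qpoch_LIMSEQ]) (use qpoch_real_mono[OF assms] in auto)
  have le1: "qpoch_inf c q \<le> 1" if "0 \<le> c" "c \<le> 1" for c :: real
    by (rule LIMSEQ_le_const2[OF qpoch_LIMSEQ]) (use qpoch_real_mono[of c 1] that in auto)
  show "qpoch_inf c q \<le> 1" using le1 assms by auto
  \<comment> \<open>The tail \<open>qpoch_inf (c * q ^ n) q\<close> is at most 1, which gives the
    last bound.\<close>
  have "c * q ^ n \<le> 1" using assms q by (simp add: mult_le_one power_le_one)
  then show "qpoch_inf c q \<le> qpoch c q n"
    using le1[of "c * q ^ n"] qpoch_real_mono(1)[of c c] assms q
    by (subst qpoch_inf_split[of c n]) (auto intro!: mult_left_le)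
qed

lemma qpoch_inf_pos:
  fixes c :: real
  assumes "0 \<le> c" "c < 1"
  shows "0 < qpoch_inf c q"
proof -
  have "qpoch_inf c q \<noteq> 0"
    using norm_less_1_mult_power_neq_1[of c] assms by (intro qpoch_inf_nonzero) auto
  then show ?thesis using qpoch_inf_real_mono(1)[of c c] assms by auto
qed

lemma qpoch_pos:
  fixes c :: real
  assumes "0 \<le> c" "c < 1"
  shows "0 < qpoch c q n"
  using qpoch_inf_pos[OF assms] qpoch_inf_real_mono(4)[of c c n] assms by linarith

text \<open>These are the tails of a convergent product with nonzero value, that is, the full
  product divided by its partial products.\<close>

lemma qpoch_inf_tendsto_1:
  fixes c :: real
  assumes "0 \<le> c" "c < 1"
  shows "(\<lambda>n. qpoch_inf (c * q ^ n) q) \<longlonglongrightarrow> 1"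
proof -
  have pos: "qpoch c q n > 0" for n by (rule qpoch_pos[OF assms])
  have "(\<lambda>n. qpoch_inf c q / qpoch c q n) \<longlonglongrightarrow> qpoch_inf c q / qpoch_inf c q"
    by (intro tendsto_intros qpoch_LIMSEQ) (use qpoch_inf_pos[OF assms] in auto)
  moreover have "qpoch_inf c q / qpoch c q n = qpoch_inf (c * q ^ n) q" for n
    using pos[of n] by (subst qpoch_inf_split[of c n]) auto
  ultimately show ?thesis using qpoch_inf_pos[OF assms] by simp
qed

text \<open>The partial products are polynomials in the argument and, by the M-test, converge
  uniformly on every closed disc of radius 1. Composition with \<open>f\<close> gives the general
  form.\<close>

lemma holomorphic_on_qpoch_inf [holomorphic_intros]:
  assumes "f holomorphic_on A"
  shows "(\<lambda>y. qpoch_inf (f y) q) holomorphic_on A"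
proof -
  have "(\<lambda>y. qpoch_inf y q) holomorphic_on UNIV"
  proof (rule holomorphic_uniform_sequence[where f = "\<lambda>n y. qpoch y q n"])
    show "(\<lambda>y. qpoch y q n) holomorphic_on UNIV" for n
      unfolding qpoch_def by (intro holomorphic_intros)
    fix x :: complex
    let ?B = "cball x 1"
    have "uniformly_convergent_on ?B (\<lambda>N y. \<Prod>k<N. 1 + (- y * of_real q ^ k))"
    proof (rule uniformly_convergent_on_prod)
      show "uniformly_convergent_on ?B (\<lambda>N y. \<Sum>n<N. norm (- y * of_real q ^ n))"
      proof (rule Weierstrass_m_test')
        show "summable (\<lambda>n. (norm x + 1) * q ^ n)"
          using q by (intro summable_mult summable_geometric) auto
        fix n y assume "y \<in> ?B"
        then have "norm y \<le> norm x + 1"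
          using norm_triangle_sub[of y x] by (simp add: dist_norm norm_minus_commute)
        then show "norm (norm (- y * of_real q ^ n)) \<le> (norm x + 1) * q ^ n"
          using q by (auto simp: norm_mult norm_power intro!: mult_right_mono)
      qed
    qed (auto intro!: continuous_intros)
    then obtain l where l: "uniform_limit ?B (\<lambda>N y. qpoch y q N) l sequentially"
      by (auto simp: uniformly_convergent_on_def qpoch_def)
    have "l y = qpoch_inf y q" if "y \<in> ?B" for y
      using tendsto_uniform_limitI[OF l that] qpoch_LIMSEQ[of y] by (rule LIMSEQ_unique)
    then have "uniform_limit ?B (\<lambda>N y. qpoch y q N) (\<lambda>y. qpoch_inf y q) sequentially"
      by (intro uniform_limit_cong'[THEN iffD1, OF _ _ l]) auto
    then show "\<exists>d>0. cball x d \<subseteq> UNIV \<and>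
        uniform_limit (cball x d) (\<lambda>n y. qpoch y q n) (\<lambda>y. qpoch_inf y q) sequentially"
      by (intro exI[of _ 1]) auto
  qed auto
  from holomorphic_on_compose_gen[OF assms this] show ?thesis by (simp add: o_def)
qed

end

section \<open>Newton interpolation at a geometric sequence\<close>

text \<open>The Newton basis for the nodes \<open>a * q ^ i\<close>. Dividing by
  \<open>(q; q)_k\<close> makes the \<open>q\<close>-difference send the element of index
  \<open>k + 1\<close> to \<open>y\<close> times that of index \<open>k\<close>. The type is generic
  because \<open>q\<close>-integrals are computed over the reals, while the identity theorem is
  applied over the complex numbers.\<close>

definition newton :: "real \<Rightarrow> real \<Rightarrow> nat \<Rightarrow> 'a :: real_normed_field \<Rightarrow> 'a" where
  "newton q a k y = (\<Prod>i<k. y - of_real (a * q ^ i)) / of_real (qpoch q q k)"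

text \<open>The weights are the factors of the terminating series that come from
  \<open>q^-k\<close>, \<open>q\<close> and the argument \<open>q\<close>. The operand is the
  sequence of node values, so passing to the next node is an index shift. Divided by
  \<open>a ^ k\<close>, this is the \<open>k\<close>-th Newton coefficient for the nodes
  \<open>a * q ^ j\<close>.\<close>

definition qdiff :: "real \<Rightarrow> nat \<Rightarrow> (nat \<Rightarrow> complex) \<Rightarrow> complex" where
  "qdiff q k g = (\<Sum>j\<le>k. of_real (qpoch (1 / q ^ k) q j / qpoch q q j * q ^ j) * g j)"

lemma newton_0 [simp]: "newton q a 0 y = 1"
  by (simp add: newton_def qpoch_def)

lemma newton_of_real: "newton q a k (of_real y :: 'a :: real_normed_field) = of_real (newton q a k y)"
  by (simp add: newton_def)

lemma newton_node_eq_0: "j < k \<Longrightarrow> newton q a k (of_real (a * q ^ j)) = 0"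
  by (auto simp: newton_def)

lemma newton_scale: "newton q a k (a * y) = a ^ k * newton q 1 k (y :: real)"
  by (simp add: newton_def flip: right_diff_distrib) (simp add: prod.distrib)

lemma continuous_on_newton [continuous_intros]:
  "continuous_on A f \<Longrightarrow> continuous_on A (\<lambda>y. newton q a k (f y))"
  unfolding newton_def divide_inverse by (intro continuous_intros)

lemma holomorphic_on_newton [holomorphic_intros]:
  "f holomorphic_on A \<Longrightarrow> (\<lambda>y. newton q a k (f y)) holomorphic_on A"
  unfolding newton_def divide_inverse by (intro holomorphic_intros)

context
  fixes q :: real
  assumes q: "0 < q" "q < 1"
begin

lemma qpoch_q_nonzero [simp]: "qpoch q q k \<noteq> 0"
  using qpoch_pos[OF q, of q k] q by simp

lemma qpoch_Suc: "qpoch c q (Suc k) = qpoch c q k * (1 - c * of_real q ^ k)"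
  by (simp add: qpoch_def)

lemma qpoch_inverse_power_eq_0: "k < j \<Longrightarrow> qpoch (1 / q ^ k) q j = 0"
  using q by (auto simp: qpoch_def)

section \<open>Newton polynomials under the dilation from \<open>y\<close> to
  \<open>q * y\<close>\<close>

lemma newton_Suc: "newton q a (Suc k) y = newton q a k y * (y - of_real (a * q ^ k)) / of_real (1 - q ^ Suc k)"
  by (simp add: newton_def qpoch_Suc)

text \<open>Since \<open>q * y - a * q ^ Suc i = q * (y - a * q ^ i)\<close>, the dilation moves
  each node to the preceding one; only the factor for the node \<open>a\<close> is left
  over.\<close>

lemma newton_Suc_mult_q:
  fixes y :: real
  shows "newton q a (Suc k) (q * y) = q ^ k * newton q a k y * (q * y - a) / (1 - q ^ Suc k)"
proof -
  have "(\<Prod>i<Suc k. q * y - a * q ^ i) = (q * y - a) * (\<Prod>i<k. q * (y - a * q ^ i))"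
    by (subst prod.lessThan_Suc_shift) (simp add: algebra_simps)
  then show ?thesis
    by (simp add: newton_def qpoch_Suc prod.distrib)
qed

lemma one_minus_power_Suc_nonzero: "1 - q ^ Suc k \<noteq> 0"
  using power_Suc_less_one[of q k] q by auto

text \<open>Both terms contain \<open>newton q a k y\<close>; what remains combines to
  \<open>y * (1 - q ^ Suc k)\<close>, and the normalisation cancels the last factor.\<close>

lemma newton_diff:
  fixes y :: real
  shows "newton q a (Suc k) y - newton q a (Suc k) (q * y) = y * newton q a k y"
proof -
  have "newton q a (Suc k) y - newton q a (Suc k) (q * y)
      = newton q a k y * (y - a * q ^ k - q ^ k * (q * y - a)) / (1 - q ^ Suc k)"
    unfolding newton_Suc_mult_q newton_Suc[of a k y] by (simp add: diff_divide_distrib algebra_simps)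
  also have "y - a * q ^ k - q ^ k * (q * y - a) = y * (1 - q ^ Suc k)"
    by (simp add: algebra_simps)
  finally show ?thesis using one_minus_power_Suc_nonzero[of k] by simp
qed

text \<open>A Pascal-type rule by which \<open>newton_interpolation\<close> passes from the node
  \<open>q ^ j\<close> to \<open>q ^ Suc j\<close>.\<close>

lemma newton_shift:
  fixes y :: real
  shows "newton q 1 (Suc k) (q * y) = q ^ Suc k * newton q 1 (Suc k) y - q ^ k * newton q 1 k y"
proof -
  have "q ^ Suc k * newton q 1 (Suc k) y - q ^ k * newton q 1 k y
      = q ^ k * newton q 1 k y * (q * (y - q ^ k) - (1 - q ^ Suc k)) / (1 - q ^ Suc k)"
    using one_minus_power_Suc_nonzero[of k] by (simp add: newton_Suc divide_simps) (simp add: algebra_simps)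
  also have "q * (y - q ^ k) - (1 - q ^ Suc k) = q * y - 1"
    by (simp add: algebra_simps)
  finally show ?thesis by (simp add: newton_Suc_mult_q)
qed

section \<open>Differences of node values and interpolation\<close>

lemma qdiff_Suc: "qdiff q (Suc k) g = qdiff q k g - qdiff q k (\<lambda>j. g (Suc j)) / of_real (q ^ k)"
proof -
  define w where "w k j = qpoch (1 / q ^ k) q j / qpoch q q j * q ^ j" for k j
  have w0: "w k 0 = 1" for k by (simp add: w_def qpoch_def)
  \<comment> \<open>A Pascal rule for the weights, from
    \<open>(q^-(k+1); q)_(j+1) = (1 - q^-(k+1)) * (q^-k; q)_j\<close>.\<close>
  have w_Suc: "w (Suc k) (Suc j) = w k (Suc j) - w k j / q ^ k" for k j
  proof -
    have "qpoch (1 / q ^ Suc k) q (Suc j) = (1 - 1 / q ^ Suc k) * qpoch (1 / q ^ k) q j"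
      proof -
      have c: "1 / q ^ Suc k * q = 1 / q ^ k" using q by simp
      have "qpoch (1 / q ^ Suc k) q (1 + j) = qpoch (1 / q ^ Suc k) q 1 * qpoch (1 / q ^ Suc k * q) q j"
        by (subst qpoch_add[OF q]) (simp only: of_real_eq_id id_apply power_one_right)
      moreover have "qpoch (1 / q ^ Suc k) q 1 = 1 - 1 / q ^ Suc k"
        by (simp add: qpoch_def)
      ultimately show ?thesis unfolding c by (simp only: plus_1_eq_Suc)
    qed
    then show ?thesis
      using q one_minus_power_Suc_nonzero[of j]
      by (simp add: w_def qpoch_Suc divide_simps) (simp add: algebra_simps)
  qed
  \<comment> \<open>The product contains the factor \<open>1 - q^-k * q^k = 0\<close>, so the index
    \<open>Suc k\<close> contributes nothing.\<close>
  have wk: "w k (Suc k) = 0"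
    by (simp add: w_def qpoch_inverse_power_eq_0)
  have "qdiff q (Suc k) g = g 0 + (\<Sum>j\<le>k. of_real (w (Suc k) (Suc j)) * g (Suc j))"
    unfolding qdiff_def w_def[symmetric] by (subst sum.atMost_Suc_shift) (simp add: w0)
  also have "\<dots> = g 0 + (\<Sum>j\<le>k. of_real (w k (Suc j)) * g (Suc j))
                 - (\<Sum>j\<le>k. of_real (w k j) * g (Suc j)) / of_real (q ^ k)"
    by (simp add: w_Suc algebra_simps sum_subtractf sum_divide_distrib)
  also have "g 0 + (\<Sum>j\<le>k. of_real (w k (Suc j)) * g (Suc j)) = (\<Sum>j\<le>Suc k. of_real (w k j) * g j)"
    by (subst sum.atMost_Suc_shift) (simp add: w0)
  also have "\<dots> = (\<Sum>j\<le>k. of_real (w k j) * g j)"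
    by (simp add: wk)
  finally show ?thesis by (simp add: qdiff_def w_def)
qed

text \<open>The index shift multiplies a geometric sequence by \<open>w\<close>, so each use of
  \<open>qdiff_Suc\<close> adds one factor. For \<open>w = q ^ m\<close> with \<open>m < k\<close>
  the product is zero.\<close>

lemma qdiff_power: "qdiff q k (\<lambda>j. w ^ j) = (\<Prod>i<k. 1 - w / of_real (q ^ i))"
proof (induction k)
  case (Suc k)
  have "qdiff q k (\<lambda>j. w ^ Suc j) = w * qdiff q k (\<lambda>j. w ^ j)"
    by (simp add: qdiff_def sum_distrib_left mult_ac)
  then show ?case using Suc by (simp add: qdiff_Suc algebra_simps)
qed (simp add: qdiff_def qpoch_def)

text \<open>Newton's formula at the \<open>j\<close>-th node, where the basis elements of index
  above \<open>j\<close> vanish. The induction keeps \<open>g\<close> arbitrary because its step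
  uses the hypothesis for the shifted sequence.\<close>

lemma newton_interpolation:
  "(\<Sum>k\<le>j. of_real (newton q 1 k (q ^ j)) * qdiff q k g) = g j"
proof (induction j arbitrary: g)
  case 0
  show ?case by (simp add: qdiff_def qpoch_def)
next
  case (Suc j)
  define P where "P k = complex_of_real (newton q 1 k (q ^ j))" for k
  have P0: "P (Suc j) = 0"
    using newton_node_eq_0[of j "Suc j" q 1, where 'a = real] by (simp add: P_def)
  have shift: "complex_of_real (newton q 1 (Suc k) (q ^ Suc j)) = of_real q ^ Suc k * P (Suc k) - of_real q ^ k * P k" for k
    using newton_shift[of k "q ^ j"] by (simp add: P_def)
  have "(\<Sum>k\<le>Suc j. of_real (newton q 1 k (q ^ Suc j)) * qdiff q k g)
      = qdiff q 0 g + (\<Sum>k\<le>j. of_real (newton q 1 (Suc k) (q ^ Suc j)) * qdiff q (Suc k) g)"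
    by (subst sum.atMost_Suc_shift) simp
  also have "\<dots> = qdiff q 0 g + (\<Sum>k\<le>j. of_real q ^ Suc k * P (Suc k) * qdiff q (Suc k) g)
                 - (\<Sum>k\<le>j. of_real q ^ k * P k * qdiff q (Suc k) g)"
    unfolding shift by (simp add: algebra_simps sum_subtractf)
  also have "qdiff q 0 g + (\<Sum>k\<le>j. of_real q ^ Suc k * P (Suc k) * qdiff q (Suc k) g)
           = (\<Sum>k\<le>Suc j. of_real q ^ k * P k * qdiff q k g)"
    by (subst sum.atMost_Suc_shift) (simp add: P_def)
  also have "\<dots> = (\<Sum>k\<le>j. of_real q ^ k * P k * qdiff q k g)"
    by (simp add: P0)
  \<comment> \<open>By \<open>qdiff_Suc\<close>, \<open>q ^ k\<close> times the drop from the
    \<open>k\<close>-th to the next difference is the \<open>k\<close>-th difference of the shifted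
    sequence.\<close>
  also have "\<dots> - (\<Sum>k\<le>j. of_real q ^ k * P k * qdiff q (Suc k) g)
           = (\<Sum>k\<le>j. P k * qdiff q k (\<lambda>j. g (Suc j)))"
    using q by (simp add: qdiff_Suc algebra_simps flip: sum_subtractf)
  also have "\<dots> = g (Suc j)"
    using Suc.IH[of "\<lambda>j. g (Suc j)"] by (simp add: P_def)
  finally show ?case .
qed

text \<open>A monomial \<open>y^m\<close> contributes to the \<open>k\<close>-th difference only for \<open>m \<ge> k\<close>, and then with a factor in \<open>[0, 1]\<close>.\<close>

lemma norm_qdiff_power_series_le:
  fixes c :: "nat \<Rightarrow> complex"
  assumes g: "\<And>j. (\<lambda>m. c m * of_real (q ^ j) ^ m) sums g j"
    and c: "\<And>m. norm (c m) \<le> C * \<rho> ^ m" and \<rho>: "0 \<le> \<rho>" "\<rho> < 1"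
  shows "norm (qdiff q k g) \<le> C * \<rho> ^ k / (1 - \<rho>)"
proof -
  define e where "e m = (\<Prod>i<k. 1 - q ^ m / q ^ i)" for m
  have e0: "e m = 0" if "m < k" for m
    using that q by (auto simp: e_def)
  have e1: "\<bar>e m\<bar> \<le> 1" if "m \<ge> k" for m
    unfolding e_def abs_prod using that q
    by (intro prod_le_1) (auto simp: divide_simps power_decreasing)
  have "(\<lambda>m. \<Sum>j\<le>k. of_real (qpoch (1 / q ^ k) q j / qpoch q q j * q ^ j) * (c m * of_real (q ^ j) ^ m))
          sums qdiff q k g"
    unfolding qdiff_def by (intro sums_sum sums_mult g)
  also have "(\<lambda>m. \<Sum>j\<le>k. of_real (qpoch (1 / q ^ k) q j / qpoch q q j * q ^ j) * (c m * of_real (q ^ j) ^ m))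
           = (\<lambda>m. c m * of_real (e m))"
  proof
    fix m
    have "(\<Sum>j\<le>k. of_real (qpoch (1 / q ^ k) q j / qpoch q q j * q ^ j) * (c m * of_real (q ^ j) ^ m))
        = c m * qdiff q k (\<lambda>j. of_real (q ^ m) ^ j)"
      by (simp add: qdiff_def sum_distrib_left mult_ac flip: power_mult)
    then show "(\<Sum>j\<le>k. of_real (qpoch (1 / q ^ k) q j / qpoch q q j * q ^ j) * (c m * of_real (q ^ j) ^ m))
        = c m * of_real (e m)"
      by (simp add: qdiff_power e_def)
  qed
  \<comment> \<open>The terms with \<open>m < k\<close> vanish; starting the series at
    \<open>k\<close> produces the factor \<open>\<rho> ^ k\<close>.\<close>
  finally have sums: "(\<lambda>m. c (m + k) * of_real (e (m + k))) sums qdiff q k g"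
    by (subst sums_zero_iff_shift) (auto simp: e0)
  have geo: "(\<lambda>m. C * \<rho> ^ k * \<rho> ^ m) sums (C * \<rho> ^ k * (1 / (1 - \<rho>)))"
    using \<rho> by (intro sums_mult geometric_sums) auto
  have "norm (c (m + k) * of_real (e (m + k))) \<le> C * \<rho> ^ k * \<rho> ^ m" for m
  proof -
    have "norm (c (m + k) * of_real (e (m + k))) \<le> norm (c (m + k)) * 1"
      unfolding norm_mult norm_of_real by (intro mult_left_mono e1) auto
    then show ?thesis using c[of "m + k"] by (simp add: power_add mult_ac)
  qed
  then have "norm (qdiff q k g) \<le> (\<Sum>m. C * \<rho> ^ k * \<rho> ^ m)"
    unfolding sums_unique[OF sums] using geo
    by (intro norm_suminf_le) (auto simp: sums_iff)
  then show ?thesis using geo by (simp add: sums_iff)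
qed

text \<open>Each factor is at most \<open>r * (1 + q ^ i)\<close>, the product of the
  \<open>1 + q ^ i\<close> is at most the exponential of a geometric series, and
  \<open>(q; q)_k\<close> is at least its limit. The constant depends on neither \<open>k\<close>
  nor \<open>y\<close>.\<close>

lemma norm_newton_le:
  fixes y :: "'a :: real_normed_field"
  assumes "0 < a" "a \<le> r" "norm y \<le> r"
  shows "norm (newton q a k y) \<le> exp (1 / (1 - q)) / qpoch_inf q q * r ^ k"
proof -
  have pos: "0 < qpoch_inf q q" "qpoch_inf q q \<le> qpoch q q k"
    using qpoch_inf_pos[OF q, of q] qpoch_inf_real_mono(4)[OF q, of q q k] q by auto
  have "norm (y - of_real (a * q ^ i)) \<le> r * (1 + q ^ i)" for i
  proof -
    have "norm (y - of_real (a * q ^ i)) \<le> norm y + norm (of_real (a * q ^ i) :: 'a)"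
      by (rule norm_triangle_ineq4)
    also have "norm (of_real (a * q ^ i) :: 'a) = a * q ^ i"
      using assms q by (simp add: norm_mult norm_power del: of_real_mult of_real_power)
    also have "\<dots> \<le> r * q ^ i" using assms q by (intro mult_right_mono) auto
    finally show ?thesis using assms by (simp add: algebra_simps)
  qed
  then have "norm (\<Prod>i<k. y - of_real (a * q ^ i)) \<le> (\<Prod>i<k. r * (1 + q ^ i))"
    unfolding prod_norm[symmetric] by (intro prod_mono) auto
  also have "\<dots> = r ^ k * (\<Prod>i<k. 1 + q ^ i)"
    by (simp add: prod.distrib)
  also have "(\<Prod>i<k. 1 + q ^ i) \<le> exp (\<Sum>i<k. q ^ i)"
    using q by (intro prod_le_exp_sum) auto
  also have "(\<Sum>i<k. q ^ i) \<le> (\<Sum>i. q ^ i)"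
    using q by (intro sum_le_suminf summable_geometric) auto
  also have "\<dots> = 1 / (1 - q)"
    using q by (intro suminf_geometric) auto
  finally have *: "norm (\<Prod>i<k. y - of_real (a * q ^ i)) \<le> r ^ k * exp (1 / (1 - q))"
    using assms by (simp add: mult_left_mono)
  have "norm (newton q a k y) = norm (\<Prod>i<k. y - of_real (a * q ^ i)) / qpoch q q k"
    using pos by (simp add: newton_def norm_divide)
  also have "\<dots> \<le> r ^ k * exp (1 / (1 - q)) / qpoch_inf q q"
    using pos assms by (intro frac_le *) auto
  finally show ?thesis by (simp add: mult_ac)
qed

end

section \<open>Fractional $q$-integral of the Newton basis\<close>

context
  fixes q :: real
  assumes q: "0 < q" "q < 1"
begin

lemma powr_less_1: "0 < \<alpha> \<Longrightarrow> q powr \<alpha> < 1"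
  using powr_less_mono2[of \<alpha> q 1] q by simp

text \<open>With \<open>c = q powr \<alpha>\<close>, all three symbols reduce to the quotient
  \<open>N / E\<close> up to elementary factors, and the claim becomes
  \<open>(1 - c * v) - (1 - v) = v * (1 - c)\<close>.\<close>

lemma qpoch_real_kernel:
  fixes v :: real
  assumes "0 < \<alpha>" "0 \<le> v" "v \<le> 1"
  shows "v * qpoch_real (q * v) q (\<alpha> - 1)
       = (qpoch_real (q * v) q \<alpha> - qpoch_real v q \<alpha>) / (1 - q powr \<alpha>)"
proof -
  define c where "c = q powr \<alpha>"
  define N where "N = qpoch_inf (q * v) q"
  define E where "E = qpoch_inf (c * v * q) q"
  have c: "0 < c" "c < 1" using q assms powr_less_1 by (auto simp: c_def)
  have cv: "0 \<le> c * v" "c * v < 1" using c assms by (auto intro: order.strict_trans1[OF mult_left_le])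
  have cvq: "c * v * q < 1" using cv q mult_left_le[of q "c * v"] by auto
  have E: "E > 0" unfolding E_def using cvq cv q by (intro qpoch_inf_pos) auto
  have D: "qpoch_inf (c * v) q = (1 - c * v) * E"
    unfolding E_def by (subst qpoch_inf_head[OF q]) simp
  have qv: "q * v * q powr (\<alpha> - 1) = c * v" using q by (simp add: c_def powr_diff)
  have 1: "qpoch_real (q * v) q (\<alpha> - 1) = N / ((1 - c * v) * E)"
    unfolding qpoch_real_def of_real_eq_id id_apply qv D N_def ..
  have "q * v * c = c * v * q" by simp
  then have 2: "qpoch_real (q * v) q \<alpha> = N / E"
    by (simp add: qpoch_real_def N_def E_def c_def mult_ac)
  have "qpoch_inf v q = (1 - v) * N"
    unfolding N_def by (subst qpoch_inf_head[OF q]) (simp add: mult.commute)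
  then have 3: "qpoch_real v q \<alpha> = (1 - v) * N / ((1 - c * v) * E)"
    using D by (simp add: qpoch_real_def c_def mult.commute)
  show ?thesis
    unfolding 1 2 3 c_def[symmetric] using E cv c
    by (simp add: divide_simps) (simp add: algebra_simps)
qed

lemma qpoch_real_kernel_scaled:
  fixes x y :: real
  assumes \<alpha>: "0 < \<alpha>" and y: "0 < y" "y \<le> x"
  shows "y * q ^ n * qpoch_real (q * (y * q ^ n) / x) q (\<alpha> - 1)
       = x / (1 - q powr \<alpha>) * (qpoch_real (y / x * q ^ Suc n) q \<alpha> - qpoch_real (y / x * q ^ n) q \<alpha>)"
proof -
  define v where "v = y / x * q ^ n"
  have x: "x > 0" using y by linarith
  have v: "0 \<le> v" "v \<le> 1"
    using y x q mult_le_one[of "y / x" "q ^ n"] by (simp_all add: v_def power_le_one)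
  have eqs: "y * q ^ n = x * v" "q * (y * q ^ n) / x = q * v" "y / x * q ^ Suc n = q * v" "y / x * q ^ n = v"
    using x by (simp_all add: v_def)
  have "x * v * qpoch_real (q * v) q (\<alpha> - 1) = x * (v * qpoch_real (q * v) q (\<alpha> - 1))" by simp
  also have "\<dots> = x / (1 - q powr \<alpha>) * (qpoch_real (q * v) q \<alpha> - qpoch_real v q \<alpha>)"
    by (subst qpoch_real_kernel[OF \<alpha> v]) simp
  finally show ?thesis unfolding eqs(2-4) unfolding eqs(1) .
qed

lemma qpoch_real_tendsto_1:
  fixes v :: real
  assumes "0 < \<alpha>" "0 \<le> v" "v \<le> 1"
  shows "(\<lambda>n. qpoch_real (v * q ^ n) q \<alpha>) \<longlonglongrightarrow> 1"
proof -
  have "v * q \<le> 1 * q" using q assms by (intro mult_right_mono) auto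
  then have vq: "v * q < 1" using q by linarith
  have c: "0 < q powr \<alpha>" "q powr \<alpha> < 1" using q assms powr_less_1 by auto
  have "v * q powr \<alpha> \<le> 1 * q powr \<alpha>" using c assms by (intro mult_right_mono) auto
  then have vc: "v * q powr \<alpha> < 1" using c by linarith
  \<comment> \<open>As \<open>v = 1\<close> is allowed, the numerator is treated from the index 1
    on, where its argument \<open>v * q\<close> is below 1.\<close>
  have "(\<lambda>n. qpoch_inf (v * q * q ^ n) q) \<longlonglongrightarrow> 1"
    using vq assms q by (intro qpoch_inf_tendsto_1) auto
  then have num: "(\<lambda>n. qpoch_inf (v * q ^ n) q) \<longlonglongrightarrow> 1"
    by (subst filterlim_sequentially_Suc[symmetric]) (simp add: mult_ac)
  have den: "(\<lambda>n. qpoch_inf (v * q powr \<alpha> * q ^ n) q) \<longlonglongrightarrow> 1"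
    using vc assms q by (intro qpoch_inf_tendsto_1) auto
  show ?thesis
    using tendsto_divide[OF num den] by (simp add: qpoch_real_def mult_ac)
qed

text \<open>
  Summation by parts: the kernel of order \<open>\<alpha>\<close> is a \<open>q\<close>-difference of the kernel of order \<open>\<alpha> + 1\<close>,
  and the \<open>q\<close>-difference of a Newton polynomial is the preceding one.
\<close>

lemma qintegral_newton_step:
  fixes x y a :: real
  assumes \<alpha>: "0 < \<alpha>" and y: "0 < y" "y \<le> x"
    and S: "(\<lambda>n. y * q ^ n * qpoch_real (q * (y * q ^ n) / x) q \<alpha> * newton q a k (y * q ^ n)) sums s"
  shows "(\<lambda>n. y * q ^ n * qpoch_real (q * (y * q ^ n) / x) q (\<alpha> - 1) * newton q a (Suc k) (y * q ^ n))
           sums (x / (1 - q powr \<alpha>) *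
                 (newton q a (Suc k) 0 - qpoch_real (y / x) q \<alpha> * newton q a (Suc k) y + s))"
proof -
  define F where "F n = qpoch_real (y / x * q ^ n) q \<alpha>" for n
  define p where "p n = newton q a (Suc k) (y * q ^ n)" for n
  define G where "G n = F n * p n" for n
  have x: "x > 0" using y by linarith
  have "F \<longlonglongrightarrow> 1"
    unfolding F_def using \<alpha> y by (intro qpoch_real_tendsto_1) auto
  moreover have "p \<longlonglongrightarrow> newton q a (Suc k) 0"
  proof -
    have "isCont (newton q a (Suc k) :: real \<Rightarrow> real) 0"
      using continuous_on_newton[of UNIV "\<lambda>y. y"]
      by (auto simp: continuous_on_eq_continuous_at)
    moreover have "(\<lambda>n. y * q ^ n) \<longlonglongrightarrow> y * 0"
      using q by (intro tendsto_intros LIMSEQ_power_zero) auto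
    ultimately show ?thesis unfolding p_def by (auto intro: isCont_tendsto_compose)
  qed
  ultimately have "G \<longlonglongrightarrow> 1 * newton q a (Suc k) 0"
    unfolding G_def by (rule tendsto_mult)
  then have "(\<lambda>n. G (Suc n) - G n) sums (newton q a (Suc k) 0 - G 0)"
    by (auto intro: telescope_sums)
  from sums_mult[OF sums_add[OF this S], of "x / (1 - q powr \<alpha>)"]
  have *: "(\<lambda>n. x / (1 - q powr \<alpha>) * (G (Suc n) - G n
               + y * q ^ n * qpoch_real (q * (y * q ^ n) / x) q \<alpha> * newton q a k (y * q ^ n)))
        sums (x / (1 - q powr \<alpha>) * (newton q a (Suc k) 0 - G 0 + s))" .
  have eq: "x / (1 - q powr \<alpha>) * (G (Suc n) - G n
               + y * q ^ n * qpoch_real (q * (y * q ^ n) / x) q \<alpha> * newton q a k (y * q ^ n))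
      = y * q ^ n * qpoch_real (q * (y * q ^ n) / x) q (\<alpha> - 1) * newton q a (Suc k) (y * q ^ n)" for n
  proof -
    have F_Suc: "qpoch_real (q * (y * q ^ n) / x) q \<alpha> = F (Suc n)"
      by (simp add: F_def mult_ac)
    have "p n - p (Suc n) = y * q ^ n * newton q a k (y * q ^ n)"
      using newton_diff[OF q, of a k "y * q ^ n"] by (simp add: p_def mult_ac)
    \<comment> \<open>The product rule for differences: adding
      \<open>F (Suc n) * (p n - p (Suc n))\<close> to the difference of \<open>F * p\<close> leaves
      only the difference of \<open>F\<close>.\<close>
    then have "G (Suc n) - G n + y * q ^ n * F (Suc n) * newton q a k (y * q ^ n) = (F (Suc n) - F n) * p n"
      unfolding G_def by (simp add: algebra_simps)
    moreover have "y * q ^ n * qpoch_real (q * (y * q ^ n) / x) q (\<alpha> - 1)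
        = x / (1 - q powr \<alpha>) * (F (Suc n) - F n)"
      unfolding F_def by (rule qpoch_real_kernel_scaled[OF \<alpha> y])
    ultimately show ?thesis unfolding F_Suc by (simp add: p_def)
  qed
  show ?thesis using * unfolding eq by (simp add: G_def F_def p_def)
qed

text \<open>The start of the summation by parts: without a Newton factor the kernel itself
  telescopes, and \<open>F\<close> tends to 1.\<close>

lemma qintegral_kernel_sums:
  fixes x y :: real
  assumes \<alpha>: "0 < \<alpha>" and y: "0 < y" "y \<le> x"
  shows "(\<lambda>n. y * q ^ n * qpoch_real (q * (y * q ^ n) / x) q (\<alpha> - 1))
           sums (x / (1 - q powr \<alpha>) * (1 - qpoch_real (y / x) q \<alpha>))"
proof -
  have x: "x > 0" using y by linarith
  define F where "F n = qpoch_real (y / x * q ^ n) q \<alpha>" for n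
  have "F \<longlonglongrightarrow> 1"
    unfolding F_def using \<alpha> y by (intro qpoch_real_tendsto_1) auto
  then have "(\<lambda>n. F (Suc n) - F n) sums (1 - F 0)" by (rule telescope_sums)
  from sums_mult[OF this, of "x / (1 - q powr \<alpha>)"]
  have *: "(\<lambda>n. x / (1 - q powr \<alpha>) * (F (Suc n) - F n)) sums (x / (1 - q powr \<alpha>) * (1 - F 0))" .
  have eq: "x / (1 - q powr \<alpha>) * (F (Suc n) - F n)
      = y * q ^ n * qpoch_real (q * (y * q ^ n) / x) q (\<alpha> - 1)" for n
  proof -
    show ?thesis
      unfolding F_def by (rule qpoch_real_kernel_scaled[OF \<alpha> y, symmetric])
  qed
  show ?thesis using * unfolding eq by (simp add: F_def)
qed

lemma qpoch_real_1: "qpoch_real 1 q \<alpha> = (0 :: real)"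
  unfolding qpoch_real_def by (subst qpoch_inf_head[OF q]) simp

text \<open>Each summation by parts lowers the degree by one and raises the order by one, hence the
  induction with \<alpha> arbitrary. The boundary term at \<open>x\<close> vanishes because
  \<open>(1; q)_\<alpha> = 0\<close>, the one at \<open>a\<close> because \<open>a\<close> is a
  node, and the values at 0 cancel between the two sums. A factor
  \<open>x / (1 - q powr \<alpha>)\<close> remains.\<close>

lemma qintegral_newton:
  fixes x a :: real
  assumes \<alpha>: "0 < \<alpha>" and a: "0 < a" "a < x"
  shows "\<exists>sx sa.
     (\<lambda>n. x * q ^ n * qpoch_real (q * (x * q ^ n) / x) q (\<alpha> - 1) * newton q a k (x * q ^ n)) sums sx \<and>
     (\<lambda>n. a * q ^ n * qpoch_real (q * (a * q ^ n) / x) q (\<alpha> - 1) * newton q a k (a * q ^ n)) sums sa \<and>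
     sx - sa = x ^ Suc k * qpoch_real (a / x) q (\<alpha> + k) / qpoch (q powr \<alpha>) q (Suc k)"
  using \<alpha>
proof (induction k arbitrary: \<alpha>)
  case 0
  have "x * (1 - qpoch_real 1 q \<alpha>) / (1 - q powr \<alpha>) - x * (1 - qpoch_real (a / x) q \<alpha>) / (1 - q powr \<alpha>)
      = x * qpoch_real (a / x) q \<alpha> / (1 - q powr \<alpha>)"
    using 0 by (simp add: qpoch_real_1 diff_divide_distrib algebra_simps)
  then show ?case
    using qintegral_kernel_sums[OF 0, of x x] qintegral_kernel_sums[OF 0, of a x] a
    by (intro exI conjI) (auto simp: qpoch_def)
next
  case (Suc k)
  from Suc.IH[of "\<alpha> + 1"] Suc.prems obtain sx sa where
    sx: "(\<lambda>n. x * q ^ n * qpoch_real (q * (x * q ^ n) / x) q \<alpha> * newton q a k (x * q ^ n)) sums sx" and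
    sa: "(\<lambda>n. a * q ^ n * qpoch_real (q * (a * q ^ n) / x) q \<alpha> * newton q a k (a * q ^ n)) sums sa" and
    diff: "sx - sa = x ^ Suc k * qpoch_real (a / x) q (\<alpha> + 1 + k) / qpoch (q powr (\<alpha> + 1)) q (Suc k)"
    by auto
  define C where "C = x / (1 - q powr \<alpha>)"
  have p: "newton q a (Suc k) a = 0"
    using newton_node_eq_0[of 0 "Suc k" q a, where 'a = real] by simp
  have "C * (newton q a (Suc k) 0 - qpoch_real (x / x) q \<alpha> * newton q a (Suc k) x + sx)
      - C * (newton q a (Suc k) 0 - qpoch_real (a / x) q \<alpha> * newton q a (Suc k) a + sa) = C * (sx - sa)"
    using a Suc.prems by (simp add: p qpoch_real_1 algebra_simps)
  also have "\<dots> = x ^ Suc (Suc k) * qpoch_real (a / x) q (\<alpha> + 1 + k) /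
                     ((1 - q powr \<alpha>) * qpoch (q powr (\<alpha> + 1)) q (Suc k))"
    unfolding diff C_def by simp
  also have "(1 - q powr \<alpha>) * qpoch (q powr (\<alpha> + 1)) q (Suc k) = qpoch (q powr \<alpha>) q (Suc (Suc k))"
    using qpoch_add[OF q, of "q powr \<alpha>" 1 "Suc k"] q by (simp add: powr_add qpoch_def)
  also have "\<alpha> + 1 + real k = \<alpha> + real (Suc k)" by simp
  finally show ?case
    using qintegral_newton_step[OF Suc.prems a(1) _ sa] qintegral_newton_step[OF Suc.prems _ _ sx] a
    unfolding C_def by (intro exI conjI) auto
qed

text \<open>\<open>(q^\<alpha>; q)_(k+1)\<close> cancels the leading factors of the infinite product
  in \<open>1 / qGamma q \<alpha>\<close>, and the remaining tail is the denominator of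
  \<open>(q; q)_(\<alpha>+k)\<close>. The factor \<open>1 - q\<close> comes from the
  \<open>q\<close>-integral; \<open>u\<close> will be \<open>(a/x; q)_(\<alpha>+k)\<close>.\<close>

lemma qGamma_constant:
  assumes \<alpha>: "0 < \<alpha>" and x: "0 < x"
  shows "(1 - q) * (x powr (\<alpha> - 1) / qGamma q \<alpha>)
           * (x ^ Suc k * u / qpoch (q powr \<alpha>) q (Suc k))
       = (1 - q) powr \<alpha> * (x powr (\<alpha> + k) * u / qpoch_real q q (\<alpha> + k))"
proof -
  define G where "G = qpoch_inf q q"
  define E where "E = qpoch_inf (q powr (\<alpha> + Suc k)) q"
  define P where "P = qpoch (q powr \<alpha>) q (Suc k)"
  have G: "G > 0" unfolding G_def using q by (intro qpoch_inf_pos) auto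
  have E: "E > 0" unfolding E_def using q \<alpha> by (intro qpoch_inf_pos powr_less_1) auto
  have P: "P > 0" unfolding P_def using q \<alpha> by (intro qpoch_pos powr_less_1) auto
  have "q powr \<alpha> * q ^ Suc k = q powr (\<alpha> + Suc k)"
    using q by (simp only: powr_add powr_realpow)
  then have 1: "qpoch_inf (q powr \<alpha>) q = P * E"
    unfolding P_def E_def by (subst qpoch_inf_split[OF q, of _ "Suc k"]) simp
  have "q * q powr (\<alpha> + k) = q powr (\<alpha> + Suc k)"
    using q by (simp add: powr_add)
  then have 2: "qpoch_real q q (\<alpha> + k) = G / E"
    by (simp add: qpoch_real_def G_def E_def)
  have 3: "x powr (\<alpha> - 1) * x ^ Suc k = x powr (\<alpha> + k)"
    using x by (simp add: powr_add powr_diff powr_realpow)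
  have 4: "(1 - q) * (1 / (1 - q) powr (1 - \<alpha>)) = (1 - q) powr \<alpha>"
    using q by (simp add: powr_diff)
  have "(1 - q) * (x powr (\<alpha> - 1) / qGamma q \<alpha>) * (x ^ Suc k * u / P)
      = ((1 - q) * (1 / (1 - q) powr (1 - \<alpha>))) * ((x powr (\<alpha> - 1) * x ^ Suc k) * u / (G / E))"
    unfolding qGamma_def 1 G_def[symmetric] using G E P q by (simp add: divide_simps)
  then show ?thesis unfolding 2 3 4 P_def .
qed

end

section \<open>Convergence of Newton series\<close>

lemma norm_sum_decreasing_weights_le:
  fixes v :: "nat \<Rightarrow> complex" and R :: "nat \<Rightarrow> real"
  assumes v: "\<And>l. norm (\<Sum>k<l. v k) \<le> e"
    and R: "\<And>k. 0 \<le> R k" "R 0 \<le> 1" "\<And>k. R (Suc k) \<le> R k"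
  shows "norm (\<Sum>k<n. v k * of_real (R k)) \<le> e"
proof -
  define V where "V n = (\<Sum>k<n. v k)" for n
  \<comment> \<open>Abel's summation by parts: the weights of the partial sums \<open>V\<close> are
    nonnegative and add up to \<open>R 0\<close>.\<close>
  have parts: "(\<Sum>k<n. v k * of_real (R k)) = of_real (R n) * V n + (\<Sum>k<n. of_real (R k - R (Suc k)) * V (Suc k))"
    by (induction n) (simp_all add: V_def algebra_simps)
  have tel: "(\<Sum>k<n. R k - R (Suc k)) = R 0 - R n"
    by (induction n) auto
  have e: "0 \<le> e" using v[of 0] by simp
  have "norm (\<Sum>k<n. v k * of_real (R k)) \<le> R n * e + (\<Sum>k<n. (R k - R (Suc k)) * e)"
    unfolding parts
  proof (intro norm_triangle_le add_mono order.trans[OF norm_sum] sum_mono)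
    show "norm (of_real (R n) * V n) \<le> R n * e"
      using v[of n] R(1)[of n] by (simp add: V_def norm_mult mult_left_mono)
    show "norm (of_real (R k - R (Suc k)) * V (Suc k)) \<le> (R k - R (Suc k)) * e" for k
      using v[of "Suc k"] R(3)[of k] unfolding norm_mult norm_of_real V_def
      by (intro mult_mono) auto
  qed
  also have "\<dots> = R 0 * e"
    unfolding sum_distrib_right[symmetric] tel by (simp add: algebra_simps)
  also have "\<dots> \<le> e" using R(2) e by (rule mult_left_le_one_le[OF _ R(1), rotated])
  finally show ?thesis .
qed

text \<open>The preceding bound, applied to blocks of the series, makes the convergence uniform in
  \<open>j\<close>, so the limit in \<open>j\<close> may be taken term by term.\<close>

lemma abel_limit_decreasing_weights:
  fixes u :: "nat \<Rightarrow> complex" and R :: "nat \<Rightarrow> nat \<Rightarrow> real"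
  assumes u: "summable u"
    and R: "\<And>j k. 0 \<le> R j k" "\<And>j k. R j k \<le> 1" "\<And>j k. R j (Suc k) \<le> R j k"
    and lim: "\<And>k. (\<lambda>j. R j k) \<longlonglongrightarrow> 1"
  shows "(\<lambda>j. \<Sum>k. u k * of_real (R j k)) \<longlonglongrightarrow> (\<Sum>k. u k)"
proof -
  define S where "S n j = (\<Sum>k<n. u k * of_real (R j k))" for n j
  have "uniformly_Cauchy_on UNIV S"
  proof (rule uniformly_Cauchy_onI')
    fix e :: real assume "e > 0"
    then obtain N where N: "\<And>m n. m \<ge> N \<Longrightarrow> norm (sum u {m..<n}) < e / 2"
      using u unfolding summable_Cauchy by (meson half_gt_zero)
    show "\<exists>M. \<forall>x\<in>UNIV. \<forall>m\<ge>M. \<forall>n>m. dist (S m x) (S n x) < e"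
    proof (intro exI[of _ N] ballI allI impI)
      fix j m n :: nat assume mn: "N \<le> m" "m < n"
      have "norm (\<Sum>k<n - m. u (m + k) * of_real (R j (m + k))) \<le> e / 2"
      proof (rule norm_sum_decreasing_weights_le)
        fix l
        have "(\<Sum>k<l. u (m + k)) = sum u {m..<m + l}"
          by (simp add: sum.atLeastLessThan_shift_0[of u m] atLeast0LessThan)
        then show "norm (\<Sum>k<l. u (m + k)) \<le> e / 2"
          using N[of m "m + l"] mn by simp
      qed (use R in auto)
      also have "(\<Sum>k<n - m. u (m + k) * of_real (R j (m + k))) = (\<Sum>k=m..<n. u k * of_real (R j k))"
        by (simp add: sum.atLeastLessThan_shift_0[of _ m] atLeast0LessThan)
      also have "\<dots> = S n j - S m j"
        unfolding S_def using sum_diff_nat_ivl[of 0 m n "\<lambda>k. u k * complex_of_real (R j k)"] mn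
        by (simp add: atLeast0LessThan)
      finally show "dist (S m j) (S n j) < e"
        using \<open>e > 0\<close> by (simp add: dist_norm norm_minus_commute)
    qed
  qed
  then obtain l where l: "uniform_limit UNIV S l sequentially"
    using Cauchy_uniformly_convergent by (auto simp: uniformly_convergent_on_def)
  have l_eq: "l j = (\<Sum>k. u k * of_real (R j k))" for j
    using tendsto_uniform_limitI[OF l, of j] by (simp add: S_def[abs_def] sums_def[symmetric] sums_iff)
  have "(l \<longlongrightarrow> (\<Sum>k. u k)) sequentially"
  proof (rule swap_uniform_limit'[OF _ _ l])
    show "\<forall>\<^sub>F n in sequentially. (S n \<longlongrightarrow> (\<Sum>k<n. u k * of_real 1)) sequentially"
      unfolding S_def by (intro always_eventually allI tendsto_intros lim)
    show "((\<lambda>n. \<Sum>k<n. u k * of_real 1) \<longlongrightarrow> (\<Sum>k. u k)) sequentially"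
      using summable_LIMSEQ[OF u] by simp
  qed auto
  then show ?thesis by (simp add: l_eq[abs_def])
qed

text \<open>Tannery's theorem for the partial sums over \<open>k\<close>, with the dominating series
  \<open>norm (w n) * suminf M\<close>.\<close>

lemma sums_interchange:
  fixes w :: "nat \<Rightarrow> complex" and P :: "nat \<Rightarrow> nat \<Rightarrow> complex"
  assumes w: "summable (\<lambda>n. norm (w n))"
    and P: "\<And>k n. norm (P k n) \<le> M k" and M: "summable M"
  shows "summable (\<lambda>n. w n * (\<Sum>k. P k n))"
    and "(\<lambda>k. \<Sum>n. w n * P k n) sums (\<Sum>n. w n * (\<Sum>k. P k n))"
proof -
  have M0: "0 \<le> M k" for k using P[of k 0] norm_ge_zero order.trans by blast
  have sumP: "summable (\<lambda>k. P k n)" for n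
    by (rule summable_comparison_test'[OF M]) (rule P)
  have sumw: "summable (\<lambda>n. w n * P k n)" for k
  proof (rule summable_comparison_test')
    show "summable (\<lambda>n. norm (w n) * M k)" using w by (rule summable_mult2)
    show "norm (w n * P k n) \<le> norm (w n) * M k" for n
      using P[of k n] by (simp add: norm_mult mult_left_mono)
  qed
  have "eventually (\<lambda>K. summable (\<lambda>n. norm (w n * (\<Sum>k<K. P k n)))) sequentially \<and>
        summable (\<lambda>n. norm (w n * (\<Sum>k. P k n))) \<and>
        ((\<lambda>K. \<Sum>n. w n * (\<Sum>k<K. P k n)) \<longlongrightarrow> (\<Sum>n. w n * (\<Sum>k. P k n))) sequentially"
  proof (rule tannerys_theorem)
    show "(\<lambda>K. w n * (\<Sum>k<K. P k n)) \<longlonglongrightarrow> w n * (\<Sum>k. P k n)" for n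
      by (intro tendsto_intros summable_LIMSEQ sumP)
    show "summable (\<lambda>n. norm (w n) * suminf M)" using w by (rule summable_mult2)
    have "norm (w n * (\<Sum>k<K. P k n)) \<le> norm (w n) * suminf M" for n K
    proof -
      have "norm (\<Sum>k<K. P k n) \<le> (\<Sum>k<K. M k)"
        by (intro order.trans[OF norm_sum] sum_mono P)
      also have "\<dots> \<le> suminf M" using M0 by (intro sum_le_suminf M) auto
      finally show ?thesis by (simp add: norm_mult mult_left_mono)
    qed
    then show "\<forall>\<^sub>F (n, K) in at_top \<times>\<^sub>F sequentially. norm (w n * (\<Sum>k<K. P k n)) \<le> norm (w n) * suminf M"
      by (intro always_eventually) auto
  qed auto
  moreover have "(\<Sum>n. w n * (\<Sum>k<K. P k n)) = (\<Sum>k<K. \<Sum>n. w n * P k n)" for K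
    unfolding sum_distrib_left by (rule suminf_sum) (rule sumw)
  ultimately show "summable (\<lambda>n. w n * (\<Sum>k. P k n))"
    and "(\<lambda>k. \<Sum>n. w n * P k n) sums (\<Sum>n. w n * (\<Sum>k. P k n))"
    by (auto simp: sums_def intro: summable_norm_cancel)
qed

section \<open>Newton series whose coefficients are bounded by a multiple of
  \<open>x^-k\<close>\<close>

context
  fixes q a x M :: real and d :: "nat \<Rightarrow> complex"
  assumes q: "0 < q" "q < 1"
    and a: "0 < a" "a < x"
    and d: "\<And>k. norm (d k) * x ^ k \<le> M"
begin

text \<open>A geometric majorant of the terms on the closed disc of radius \<open>r\<close>,
  combining the bound on the coefficients with \<open>norm_newton_le\<close>.\<close>

definition newton_majorant :: "real \<Rightarrow> nat \<Rightarrow> real" where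
  "newton_majorant r k = M * (exp (1 / (1 - q)) / qpoch_inf q q) * (r / x) ^ k"

lemma summable_newton_majorant:
  assumes "0 \<le> r" "r < x"
  shows "summable (newton_majorant r)"
  unfolding newton_majorant_def using assms
  by (intro summable_mult summable_geometric) auto

lemma norm_newton_term_le:
  fixes y :: complex
  assumes "a \<le> r" "norm y \<le> r"
  shows "norm (d k * newton q a k y) \<le> newton_majorant r k"
proof -
  let ?B = "exp (1 / (1 - q)) / qpoch_inf q q"
  have x: "x > 0" using a by linarith
  have M: "0 \<le> M" using d[of 0] norm_ge_zero[of "d 0"] by (simp del: norm_ge_zero)
  have B: "0 < ?B" using qpoch_inf_pos[OF q, of q] q by simp
  have "norm (d k * newton q a k y) \<le> norm (d k) * (?B * r ^ k)"
    unfolding norm_mult using a assms by (intro mult_left_mono norm_newton_le[OF q]) auto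
  also have "\<dots> = norm (d k) * x ^ k * (?B * (r / x) ^ k)"
    using x by (simp add: power_divide)
  also have "\<dots> \<le> M * (?B * (r / x) ^ k)"
    using B x a assms by (intro mult_right_mono d mult_nonneg_nonneg) (auto simp del: divide_le_eq)
  finally show ?thesis by (simp add: newton_majorant_def mult_ac)
qed

lemma holomorphic_on_newton_series: "(\<lambda>y. \<Sum>k. d k * newton q a k y) holomorphic_on ball 0 x"
proof (rule holomorphic_uniform_sequence)
  show "(\<lambda>y. \<Sum>k<n. d k * newton q a k y) holomorphic_on ball 0 x" for n
    by (intro holomorphic_intros)
  fix z :: complex assume "z \<in> ball 0 x"
  then have z: "norm z < x" by simp
  define e where "e = (x - norm z) / 2"
  \<comment> \<open>The majorant is available only for radii that are at least \<open>a\<close>, so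
    that the nodes lie in the disc.\<close>
  define r where "r = max a (norm z + e)"
  have e: "e > 0" "norm z + e < x" using z by (auto simp: e_def field_simps)
  have r: "a \<le> r" "norm z + e \<le> r" "r < x" using e a by (auto simp: r_def)
  have in_r: "norm y \<le> r" if "y \<in> cball z e" for y
    using that r norm_triangle_sub[of y z] by (simp add: dist_norm norm_minus_commute)
  have "uniform_limit (cball z e) (\<lambda>n y. \<Sum>k<n. d k * newton q a k y)
          (\<lambda>y. \<Sum>k. d k * newton q a k y) sequentially"
    using a r by (intro Weierstrass_m_test[of _ _ "newton_majorant r"] norm_newton_term_le
                    summable_newton_majorant in_r) auto
  moreover have "cball z e \<subseteq> ball 0 x"
    using in_r r by fastforce
  ultimately show "\<exists>e>0. cball z e \<subseteq> ball 0 x \<and>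
      uniform_limit (cball z e) (\<lambda>n y. \<Sum>k<n. d k * newton q a k y)
          (\<lambda>y. \<Sum>k. d k * newton q a k y) sequentially"
    using e by blast
qed auto

section \<open>Identification of the Newton series with the quotient of \<open>H\<close> by
  \<open>G\<close>\<close>

context
  fixes g :: "nat \<Rightarrow> complex" and G H :: "complex \<Rightarrow> complex"
  assumes d_eq: "\<And>k. d k = qdiff q k g / of_real (a ^ k)"
    and hol: "G holomorphic_on ball 0 x" "H holomorphic_on ball 0 x"
    and g: "\<And>j. G (of_real (a * q ^ j)) * g j = H (of_real (a * q ^ j))"
begin

text \<open>At a node the series is finite; rescaling to \<open>a = 1\<close> cancels the power
  \<open>a ^ k\<close> in the coefficient.\<close>

lemma newton_series_node: "(\<Sum>k. d k * newton q a k (of_real (a * q ^ j))) = g j"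
proof -
  have "(\<lambda>k. d k * newton q a k (of_real (a * q ^ j)))
          sums (\<Sum>k\<le>j. d k * newton q a k (of_real (a * q ^ j)))"
    by (rule sums_finite) (auto simp: newton_node_eq_0 simp del: of_real_mult of_real_power)
  also have "(\<Sum>k\<le>j. d k * newton q a k (of_real (a * q ^ j)))
           = (\<Sum>k\<le>j. of_real (newton q 1 k (q ^ j)) * qdiff q k g)"
    unfolding newton_of_real newton_scale d_eq using a by (intro sum.cong) auto
  also have "\<dots> = g j" by (rule newton_interpolation[OF q])
  finally show ?thesis by (simp add: sums_iff)
qed

text \<open>The identity theorem on the disc. The product form keeps the compared functions
  holomorphic at zeros of \<open>G\<close>.\<close>

lemma newton_series_eq:
  assumes "y \<in> ball 0 x"
  shows "G y * (\<Sum>k. d k * newton q a k y) = H y"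
proof -
  define U where "U = range (\<lambda>j. complex_of_real (a * q ^ j))"
  have in_ball: "complex_of_real (a * q ^ j) \<in> ball 0 x" for j
  proof -
    have "a * q ^ j \<le> a * 1" using a q by (intro mult_left_mono power_le_one) auto
    then have "a * q ^ j < x" using a by linarith
    then show ?thesis using a q by (simp add: norm_mult norm_power)
  qed
  have "(\<lambda>j. complex_of_real (a * q ^ j)) \<longlonglongrightarrow> complex_of_real (a * 0)"
    using q by (intro tendsto_intros LIMSEQ_power_zero) auto
  moreover have "complex_of_real (a * q ^ j) \<in> U - {0}" for j
    using a q by (auto simp: U_def)
  ultimately have lim: "0 islimpt U"
    unfolding islimpt_sequential by (intro exI[of _ "\<lambda>j. complex_of_real (a * q ^ j)"]) auto
  have "G y * (\<Sum>k. d k * newton q a k y) - H y = 0"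
  proof (rule analytic_continuation[where f = "\<lambda>y. G y * (\<Sum>k. d k * newton q a k y) - H y"
          and S = "ball 0 x" and U = U and \<xi> = 0])
    show "(\<lambda>y. G y * (\<Sum>k. d k * newton q a k y) - H y) holomorphic_on ball 0 x"
      by (intro holomorphic_intros hol holomorphic_on_newton_series)
    show "U \<subseteq> ball 0 x" using in_ball by (auto simp: U_def)
    show "G z * (\<Sum>k. d k * newton q a k z) - H z = 0" if "z \<in> U" for z
      using that g newton_series_node unfolding U_def by (auto simp del: of_real_mult of_real_power)
  qed (use a lim assms in auto)
  then show ?thesis by simp
qed

text \<open>The term at \<open>y j\<close> is the term at \<open>x\<close> times a weight
  \<open>R j k\<close> in \<open>[0, 1]\<close> that decreases in \<open>k\<close> and tends to 1 in
  \<open>j\<close>. Abel's argument therefore carries the identity from inside the disc to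
  \<open>x\<close>.\<close>

lemma newton_series_eq_boundary:
  assumes cont: "isCont G (of_real x)" "isCont H (of_real x)"
    and summable: "summable (\<lambda>k. d k * newton q a k (of_real x))"
  shows "G (of_real x) * (\<Sum>k. d k * newton q a k (of_real x)) = H (of_real x)"
proof -
  \<comment> \<open>These points start at \<open>a\<close> and increase to \<open>x\<close>, so no
    factor \<open>y j - a * q ^ i\<close> is negative.\<close>
  define y where "y j = x - (x - a) / real (Suc j)" for j
  have y: "a \<le> y j" "y j < x" for j
  proof -
    have "(x - a) / real (Suc j) \<le> (x - a) / 1" using a by (intro divide_left_mono) auto
    moreover have "(x - a) / real (Suc j) > 0" using a by simp
    ultimately show "a \<le> y j" "y j < x" by (auto simp: y_def)
  qed
  have "y \<longlonglongrightarrow> x - 0"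
    unfolding y_def by (intro tendsto_diff tendsto_const LIMSEQ_Suc[OF lim_const_over_n])
  then have lim: "y \<longlonglongrightarrow> x" by simp
  define R where "R j k = (\<Prod>i<k. (y j - a * q ^ i) / (x - a * q ^ i))" for j k
  have aq: "a * q ^ i \<le> a" "0 < a * q ^ i" for i
    using a q by (simp_all add: mult_left_le power_le_one)
  have pos: "x - a * q ^ i > 0" for i using aq[of i] a by linarith
  have R01: "0 \<le> (y j - a * q ^ i) / (x - a * q ^ i)" "(y j - a * q ^ i) / (x - a * q ^ i) \<le> 1" for i j
    using y[of j] aq[of i] pos[of i] by (auto intro!: divide_nonneg_pos)
  have R0: "0 \<le> R j k" for j k unfolding R_def by (intro prod_nonneg R01 ballI)
  have R1: "R j k \<le> 1" for j k unfolding R_def by (intro prod_le_1 conjI R01)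
  have R_Suc: "R j (Suc k) \<le> R j k" for j k
    using mult_left_mono[OF R01(2) R0, of j k j k] by (simp add: R_def)
  have "(\<lambda>j. R j k) \<longlonglongrightarrow> (\<Prod>i<k. (x - a * q ^ i) / (x - a * q ^ i))" for k
    unfolding R_def using pos by (intro tendsto_intros lim) (auto simp: less_imp_neq[symmetric])
  moreover have "(\<Prod>i<k. (x - a * q ^ i) / (x - a * q ^ i)) = 1" for k
    using pos by (intro prod.neutral) (auto simp: less_imp_neq[symmetric])
  ultimately have R_lim: "(\<lambda>j. R j k) \<longlonglongrightarrow> 1" for k by simp
  have term_eq: "d k * newton q a k (of_real x) * of_real (R j k) = d k * newton q a k (of_real (y j))" for j k
  proof -
    have "(\<Prod>i<k. x - a * q ^ i) \<noteq> 0" using pos by (auto simp: less_imp_neq[symmetric])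
    then have "newton q a k x * R j k = newton q a k (y j)"
      by (simp add: newton_def R_def prod_dividef)
    then show ?thesis unfolding newton_of_real by (simp flip: of_real_mult)
  qed
  have "(\<lambda>j. \<Sum>k. d k * newton q a k (of_real (y j))) \<longlonglongrightarrow> (\<Sum>k. d k * newton q a k (of_real x))"
    using abel_limit_decreasing_weights[where R = R, OF summable R0 R1 R_Suc R_lim] unfolding term_eq .
  moreover have lim': "(\<lambda>j. complex_of_real (y j)) \<longlonglongrightarrow> of_real x"
    by (intro tendsto_intros lim)
  ultimately have "(\<lambda>j. G (of_real (y j)) * (\<Sum>k. d k * newton q a k (of_real (y j))))
      \<longlonglongrightarrow> G (of_real x) * (\<Sum>k. d k * newton q a k (of_real x))"
    by (intro tendsto_mult isCont_tendsto_compose[OF cont(1)])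
  moreover have "G (of_real (y j)) * (\<Sum>k. d k * newton q a k (of_real (y j))) = H (of_real (y j))" for j
    using y[of j] a by (intro newton_series_eq) auto
  ultimately have "(\<lambda>j. H (of_real (y j))) \<longlonglongrightarrow> G (of_real x) * (\<Sum>k. d k * newton q a k (of_real x))"
    by simp
  moreover have "(\<lambda>j. H (of_real (y j))) \<longlonglongrightarrow> H (of_real x)"
    by (intro isCont_tendsto_compose[OF cont(2)] lim')
  ultimately show ?thesis by (rule LIMSEQ_unique)
qed

end

end

section \<open>Termwise fractional $q$-integration\<close>

context
  fixes q :: real
  assumes q: "0 < q" "q < 1"
begin

text \<open>The argument of the denominator lies in \<open>[0, c]\<close>, so the denominator lies
  between \<open>qpoch_inf c q\<close> and 1. The bounds are uniform in \<nu>.\<close>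

lemma qpoch_real_bounds:
  fixes c :: real
  assumes "0 \<le> c" "c < 1" "0 \<le> \<nu>"
  shows "qpoch_inf c q \<le> qpoch_real c q \<nu>" "qpoch_real c q \<nu> \<le> 1"
proof -
  have p: "0 < q powr \<nu>" "q powr \<nu> \<le> 1"
    using q assms powr_mono2[of \<nu> q 1] by auto
  have c: "0 \<le> c * q powr \<nu>" "c * q powr \<nu> \<le> c"
    using p assms by (auto intro!: mult_left_le)
  have le: "qpoch_inf c q \<le> qpoch_inf (c * q powr \<nu>) q" "qpoch_inf (c * q powr \<nu>) q \<le> 1"
    using qpoch_inf_real_mono(2,3)[OF q c] assms by auto
  have pos: "0 < qpoch_inf c q" using assms by (intro qpoch_inf_pos[OF q]) auto
  show "qpoch_inf c q \<le> qpoch_real c q \<nu>" "qpoch_real c q \<nu> \<le> 1"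
    using le pos by (simp_all add: qpoch_real_def pos_le_divide_eq mult_left_le)
qed

text \<open>The order \<open>\<alpha> - 1\<close> may be negative, but
  \<open>q * v * q powr (\<alpha> - 1) = v * q powr \<alpha>\<close> still lies in the unit
  interval.\<close>

lemma qpoch_real_kernel_nonneg:
  fixes v :: real
  assumes "0 < \<alpha>" "0 \<le> v" "v \<le> 1"
  shows "0 \<le> qpoch_real (q * v) q (\<alpha> - 1)"
proof -
  have c: "0 < q powr \<alpha>" "q powr \<alpha> < 1" using q assms powr_less_1[OF q] by auto
  have eq: "q * v * q powr (\<alpha> - 1) = v * q powr \<alpha>" using q by (simp add: powr_diff)
  show ?thesis
    unfolding qpoch_real_def of_real_eq_id id_apply eq
    using assms c q qpoch_inf_real_mono(1)[OF q, of "q * v" "q * v"]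
      qpoch_inf_real_mono(1)[OF q, of "v * q powr \<alpha>" "v * q powr \<alpha>"]
    by (simp add: mult_le_one)
qed

text \<open>The terms are nonnegative, so the telescoped sum already gives absolute
  convergence.\<close>

lemma summable_qintegral_kernel:
  fixes x y :: real
  assumes \<alpha>: "0 < \<alpha>" and y: "0 < y" "y \<le> x"
  shows "summable (\<lambda>n. norm (complex_of_real (y * q ^ n * qpoch_real (q * (y * q ^ n) / x) q (\<alpha> - 1))))"
proof -
  have "0 \<le> qpoch_real (q * (y * q ^ n) / x) q (\<alpha> - 1)" for n
  proof -
    have "0 \<le> y * q ^ n / x" "y * q ^ n / x \<le> 1"
      using y q mult_le_one[of "y / x" "q ^ n"] by (simp_all add: power_le_one)
    then show ?thesis using qpoch_real_kernel_nonneg[OF \<alpha>, of "y * q ^ n / x"] by simp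
  qed
  then show ?thesis
    using qintegral_kernel_sums[OF q \<alpha> y] y q
    by (simp add: abs_mult sums_iff del: of_real_mult of_real_power)
qed

end

text \<open>Convergence of the right-hand series bounds \<open>norm (d k) * x ^ k\<close>, so sums
  may be interchanged at every point of the two lattices inside the disc. Only the point
  \<open>x\<close> itself is on the boundary: its series is isolated by subtraction, which proves
  that it converges, and the boundary lemma gives its sum.\<close>

lemma frac_qintegral_newton_series:
  fixes q \<alpha> a x :: real and G H :: "complex \<Rightarrow> complex" and d :: "nat \<Rightarrow> complex"
  defines "f \<equiv> \<lambda>y::real. H y / G y"
  defines "d \<equiv> \<lambda>k. qdiff q k (\<lambda>j. f (a * q ^ j)) / of_real (a ^ k)"
  defines "c \<equiv> \<lambda>k::nat. x powr (\<alpha> + k) * qpoch_real (a / x) q (\<alpha> + k) / qpoch_real q q (\<alpha> + k)"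
  assumes q: "0 < q" "q < 1" and \<alpha>: "0 < \<alpha>" and a: "0 < a" "a < x"
    and hol: "G holomorphic_on UNIV" "H holomorphic_on UNIV"
    and Ga: "\<And>j. G (of_real (a * q ^ j)) \<noteq> 0" and Gx: "\<And>j. G (of_real (x * q ^ j)) \<noteq> 0"
    and summable: "summable (\<lambda>k. of_real (c k) * d k)"
  shows "frac_qintegral q a \<alpha> f x = of_real ((1 - q) powr \<alpha>) * (\<Sum>k. of_real (c k) * d k)"
proof -
  have x: "0 < x" using a by linarith
  define K where "K y = qpoch_real (q * y / x) q (\<alpha> - 1)" for y :: real
  have "Bseq (\<lambda>k. of_real (c k) * d k)"
    using summable by (intro convergent_imp_Bseq) (meson convergentI summable_LIMSEQ_zero)
  then obtain M where M: "\<And>k. norm (of_real (c k) * d k) \<le> M" by (elim BseqE) blast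
  \<comment> \<open>A lower bound for \<open>c k / x ^ k\<close>: the numerator symbol is at least
    \<open>qpoch_inf (a / x) q\<close> and the denominator symbol at most 1.\<close>
  define L where "L = x powr \<alpha> * qpoch_inf (a / x) q"
  have L: "L > 0" unfolding L_def using x a qpoch_inf_pos[OF q, of "a / x"] by simp
  have c_ge: "L * x ^ k \<le> c k" for k
  proof -
    have "qpoch_inf (a / x) q / 1 \<le> qpoch_real (a / x) q (\<alpha> + k) / qpoch_real q q (\<alpha> + k)"
      using qpoch_real_bounds[OF q, of "a / x" "\<alpha> + k"] qpoch_real_bounds[OF q, of q "\<alpha> + k"]
        qpoch_inf_pos[OF q, of "a / x"] qpoch_inf_pos[OF q, of q] a \<alpha> q x
      by (intro frac_le) auto
    from mult_left_mono[OF this, of "x powr (\<alpha> + k)"] show ?thesis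
      using x by (simp add: c_def L_def powr_add powr_realpow mult_ac)
  qed
  have d_bound: "norm (d k) * x ^ k \<le> M / L" for k
  proof -
    have "norm (d k) * x ^ k * L \<le> norm (d k) * c k"
      using mult_left_mono[OF c_ge[of k], of "norm (d k)"] by (simp add: mult_ac)
    also have "\<dots> \<le> norm (d k) * \<bar>c k\<bar>" by (intro mult_left_mono) auto
    also have "\<dots> \<le> M" using M[of k] by (simp add: norm_mult mult.commute)
    finally show ?thesis using L by (simp add: pos_le_divide_eq)
  qed
  define N where "N y = (\<Sum>k. d k * newton q a k (of_real y))" for y :: real
  have f_mult: "G (of_real y) * f y = H (of_real y)" if "G (of_real y) \<noteq> 0" for y
    using that by (simp add: f_def)
  have hol': "G holomorphic_on ball 0 x" "H holomorphic_on ball 0 x"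
    using hol by (auto intro: holomorphic_on_subset)
  note newton = newton_series_eq[OF q a d_bound _ hol', where g = "\<lambda>j. f (a * q ^ j)",
      OF meta_eq_to_obj_eq[OF d_def, THEN fun_cong] f_mult[OF Ga]]
  have N_eq: "N y = f y" if "0 \<le> y" "y < x" "G (of_real y) \<noteq> 0" for y
    using newton[of "of_real y"] that by (simp add: N_def f_def field_simps)
  have xq: "x * q ^ Suc n < x" for n
    using x q power_Suc_less_one[of q n] by simp
  have aq: "a * q ^ n \<le> a" for n using a q by (simp add: mult_left_le power_le_one)
  have N_x: "N (x * q ^ Suc n) = f (x * q ^ Suc n)" for n
    using xq[of n] x q Gx[of "Suc n"] by (intro N_eq) auto
  have N_a: "N (a * q ^ n) = f (a * q ^ n)" for n
    using order.strict_trans1[OF aq[of n] a(2)] a q Ga[of n] by (intro N_eq) auto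

  define wx where "wx n = complex_of_real (x * q ^ n * K (x * q ^ n))" for n
  define wa where "wa n = complex_of_real (a * q ^ n * K (a * q ^ n))" for n
  define px where "px k n = d k * newton q a k (of_real (x * q ^ n))" for k n
  define pa where "pa k n = d k * newton q a k (of_real (a * q ^ n))" for k n
  have wx: "summable (\<lambda>n. norm (wx n))" and wa: "summable (\<lambda>n. norm (wa n))"
    unfolding wx_def wa_def K_def using a x
    by (intro summable_qintegral_kernel[OF q \<alpha>]; simp)+
  have px_bound: "norm (px k (Suc n)) \<le> newton_majorant q x (M / L) (max a (x * q)) k" for k n
  proof -
    have "x * q ^ Suc n \<le> x * q ^ 1"
      using x q by (intro mult_left_mono power_decreasing) auto
    moreover have "norm (complex_of_real (x * q ^ Suc n)) = x * q ^ Suc n"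
      unfolding norm_of_real using x q by (intro abs_of_nonneg) auto
    ultimately show ?thesis unfolding px_def
      by (intro norm_newton_term_le[OF q a d_bound]) auto
  qed
  have pa_bound: "norm (pa k n) \<le> newton_majorant q x (M / L) a k" for k n
    unfolding pa_def using aq[of n] a q
    by (intro norm_newton_term_le[OF q a d_bound]) (auto simp: norm_mult norm_power)
  have maj: "summable (newton_majorant q x (M / L) r)" if "0 \<le> r" "r < x" for r
    using summable_newton_majorant[OF q a d_bound that] .
  have "summable (\<lambda>n. norm (wx (Suc n)))" using wx by (subst summable_Suc_iff)
  moreover have "0 \<le> max a (x * q)" "max a (x * q) < x" using a x q xq[of 0] by auto
  ultimately have ix: "summable (\<lambda>n. wx (Suc n) * f (x * q ^ Suc n))"
      "(\<lambda>k. \<Sum>n. wx (Suc n) * px k (Suc n)) sums (\<Sum>n. wx (Suc n) * f (x * q ^ Suc n))"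
    using sums_interchange[where w = "\<lambda>n. wx (Suc n)" and P = "\<lambda>k n. px k (Suc n)", OF _ px_bound maj]
    unfolding N_x[symmetric] N_def px_def by blast+
  have ia: "summable (\<lambda>n. wa n * f (a * q ^ n))"
      "(\<lambda>k. \<Sum>n. wa n * pa k n) sums (\<Sum>n. wa n * f (a * q ^ n))"
    using sums_interchange[where w = wa and P = pa, OF wa pa_bound maj] a
    unfolding N_a[symmetric] N_def pa_def by auto

  define \<kappa> where "\<kappa> = (1 - q) * (x powr (\<alpha> - 1) / qGamma q \<alpha>)"
  have \<kappa>: "\<kappa> \<noteq> 0"
    using qpoch_inf_pos[OF q, of q] qpoch_inf_pos[OF q, of "q powr \<alpha>"] powr_less_1[OF q \<alpha>] q x
    by (simp add: \<kappa>_def qGamma_def)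
  \<comment> \<open>The fractional integral of the \<open>k\<close>-th Newton term is the
    \<open>k\<close>-th term of the claimed series; the point \<open>x\<close> is kept
    apart.\<close>
  have key: "of_real \<kappa> * (wx 0 * px k 0 + (\<Sum>n. wx (Suc n) * px k (Suc n)) - (\<Sum>n. wa n * pa k n))
           = of_real ((1 - q) powr \<alpha>) * (of_real (c k) * d k)" for k
  proof -
    obtain sx sa where
      sx: "(\<lambda>n. x * q ^ n * K (x * q ^ n) * newton q a k (x * q ^ n)) sums sx" and
      sa: "(\<lambda>n. a * q ^ n * K (a * q ^ n) * newton q a k (a * q ^ n)) sums sa" and
      diff: "sx - sa = x ^ Suc k * qpoch_real (a / x) q (\<alpha> + k) / qpoch (q powr \<alpha>) q (Suc k)"
      using qintegral_newton[OF q \<alpha> a, of k] unfolding K_def by blast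
    have "(\<lambda>n. d k * of_real (x * q ^ n * K (x * q ^ n) * newton q a k (x * q ^ n))) sums (d k * of_real sx)"
      by (intro sums_mult sums_of_real sx)
    also have "(\<lambda>n. d k * of_real (x * q ^ n * K (x * q ^ n) * newton q a k (x * q ^ n))) = (\<lambda>n. wx n * px k n)"
      unfolding wx_def px_def newton_of_real by (intro ext) (simp add: mult_ac)
    finally have "(\<lambda>n. wx (Suc n) * px k (Suc n)) sums (d k * of_real sx - wx 0 * px k 0)"
      by (subst sums_Suc_iff[of "\<lambda>n. wx n * px k n"]) simp
    moreover have "(\<lambda>n. d k * of_real (a * q ^ n * K (a * q ^ n) * newton q a k (a * q ^ n))) sums (d k * of_real sa)"
      by (intro sums_mult sums_of_real sa)
    moreover have "(\<lambda>n. d k * of_real (a * q ^ n * K (a * q ^ n) * newton q a k (a * q ^ n))) = (\<lambda>n. wa n * pa k n)"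
      unfolding wa_def pa_def newton_of_real by (intro ext) (simp add: mult_ac)
    ultimately have "wx 0 * px k 0 + (\<Sum>n. wx (Suc n) * px k (Suc n)) - (\<Sum>n. wa n * pa k n)
        = d k * of_real (sx - sa)"
      by (simp add: sums_iff algebra_simps)
    moreover have "\<kappa> * (sx - sa) = (1 - q) powr \<alpha> * c k"
      unfolding diff c_def \<kappa>_def using qGamma_constant[OF q \<alpha> x, of k "qpoch_real (a / x) q (\<alpha> + k)"]
      by simp
    then have "complex_of_real \<kappa> * of_real (sx - sa) = of_real ((1 - q) powr \<alpha>) * of_real (c k)"
      unfolding of_real_mult[symmetric] by (rule arg_cong)
    ultimately show ?thesis by (simp add: mult_ac)
  qed
  define S where "S = of_real ((1 - q) powr \<alpha>) * (\<Sum>k. of_real (c k) * d k)"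
  have "(\<lambda>k. of_real ((1 - q) powr \<alpha>) * (of_real (c k) * d k)) sums S"
    unfolding S_def by (intro sums_mult summable_sums summable)
  from sums_divide[OF this, of "of_real \<kappa>"]
  have S: "(\<lambda>k. wx 0 * px k 0 + (\<Sum>n. wx (Suc n) * px k (Suc n)) - (\<Sum>n. wa n * pa k n)) sums (S / of_real \<kappa>)"
    unfolding key[symmetric] using \<kappa> by simp
  \<comment> \<open>Removing the two series known to converge leaves the contribution of the point
    \<open>x\<close>.\<close>
  from sums_add[OF sums_diff[OF S ix(2)] ia(2)]
  have S0: "(\<lambda>k. wx 0 * px k 0) sums
      (S / of_real \<kappa> - (\<Sum>n. wx (Suc n) * f (x * q ^ Suc n)) + (\<Sum>n. wa n * f (a * q ^ n)))"
    by simp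
  \<comment> \<open>\<open>K x\<close> is \<open>(q; q)_(\<alpha>-1)\<close>, a quotient of positive
    products, so the weight of the point \<open>x\<close> can be divided out.\<close>
  have "K x > 0"
    using qpoch_inf_pos[OF q, of q] qpoch_inf_pos[OF q, of "q powr \<alpha>"] powr_less_1[OF q \<alpha>] q x
    by (simp add: K_def qpoch_real_def powr_diff)
  then have wx0: "wx 0 \<noteq> 0" using x by (simp add: wx_def)
  have px0: "summable (\<lambda>k. px k 0)"
    using S0 wx0 by (auto simp: sums_iff)
  have "isCont G (of_real x)" "isCont H (of_real x)"
    using hol by (auto simp: continuous_on_eq_continuous_at dest!: holomorphic_on_imp_continuous_on)
  then have "G (of_real x) * N x = H (of_real x)"
    using px0 newton_series_eq_boundary[OF q a d_bound _ hol', where g = "\<lambda>j. f (a * q ^ j)",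
      OF meta_eq_to_obj_eq[OF d_def, THEN fun_cong] f_mult[OF Ga]]
    by (simp add: N_def px_def)
  then have Nx: "N x = f x" using Gx[of 0] by (simp add: f_def field_simps)
  have "(\<lambda>k. wx 0 * px k 0) sums (wx 0 * N x)"
    using sums_mult[OF summable_sums[OF px0], of "wx 0"] by (simp add: px_def N_def)
  with S0 have S_eq: "S / of_real \<kappa> = wx 0 * f x + (\<Sum>n. wx (Suc n) * f (x * q ^ Suc n)) - (\<Sum>n. wa n * f (a * q ^ n))"
    unfolding Nx by (auto simp: sums_iff algebra_simps)
  have wx_summable: "summable (\<lambda>n. wx n * f (x * q ^ n))"
    using ix(1) by (subst (asm) summable_Suc_iff[of "\<lambda>n. wx n * f (x * q ^ n)"])
  note S_eq
  also have "wx 0 * f x + (\<Sum>n. wx (Suc n) * f (x * q ^ Suc n)) = (\<Sum>n. wx n * f (x * q ^ n))"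
    using suminf_split_head[OF wx_summable] by simp
  also have "\<dots> - (\<Sum>n. wa n * f (a * q ^ n)) = (\<Sum>n. wx n * f (x * q ^ n) - wa n * f (a * q ^ n))"
    by (rule suminf_diff[OF wx_summable ia(1)])
  finally have "S = of_real \<kappa> * (\<Sum>n. wx n * f (x * q ^ n) - wa n * f (a * q ^ n))"
    using \<kappa> by (simp add: field_simps)
  moreover have "frac_qintegral q a \<alpha> f x = of_real \<kappa> * (\<Sum>n. wx n * f (x * q ^ n) - wa n * f (a * q ^ n))"
  proof -
    have "(of_real x * (of_real (K (x * q ^ n)) * f (x * q ^ n)) -
           of_real a * (of_real (K (a * q ^ n)) * f (a * q ^ n))) * of_real q ^ n
        = wx n * f (x * q ^ n) - wa n * f (a * q ^ n)" for n
      by (simp add: wx_def wa_def algebra_simps)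
    then show ?thesis
      unfolding frac_qintegral_def qintegral_def K_def[symmetric] \<kappa>_def by simp
  qed
  ultimately show ?thesis unfolding S_def by simp
qed

section \<open>The terminating series as a $q$-difference\<close>

text \<open>With \<open>q^-k\<close> added above, the exponent \<open>1 + s - r\<close> is 0 and the
  sign factor disappears; the terms beyond \<open>k\<close> vanish.\<close>

lemma qhyp_eq_qdiff:
  fixes q :: real and F :: "nat \<Rightarrow> complex" and as bs :: "complex list"
  assumes q: "0 < q" "q < 1" and len: "length as = length bs"
    and F: "\<And>j. F j = F 0 * (qpochs as q j / qpochs bs q j)"
  shows "F 0 * qhyp (complex_of_real (q powi (- int k)) # as) bs q q = qdiff q k F"
proof -
  have c: "q powi (- int k) = 1 / q ^ k" by (simp add: power_int_minus divide_inverse)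
  define t where "t n = of_real (qpoch (1 / q ^ k) q n / qpoch q q n * q ^ n)
                        * (qpochs as q n / qpochs bs q n)" for n
  have "qhyp (complex_of_real (q powi (- int k)) # as) bs q q = (\<Sum>n. t n)"
    unfolding qhyp_def c t_def qpochs_def list.map prod_list.Cons qpoch_of_real[OF q]
    by (simp add: len mult_ac)
  also have "\<dots> = (\<Sum>n\<le>k. t n)"
    by (rule suminf_finite) (auto simp: t_def qpoch_inverse_power_eq_0[OF q])
  also have "F 0 * \<dots> = qdiff q k F"
    unfolding qdiff_def sum_distrib_left
  proof (rule sum.cong)
    fix j
    show "F 0 * t j = of_real (qpoch (1 / q ^ k) q j / qpoch q q j * q ^ j) * F j"
      unfolding F[of j] t_def by (simp only: mult_ac)
  qed simp
  finally show ?thesis .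
qed

text \<open>Taylor coefficients of order \<open>\<rho>^-m\<close> with \<open>x < \<rho> < R\<close>
  make the \<open>k\<close>-th difference of order \<open>(a / \<rho>) ^ k\<close>. The remaining
  factors contribute at most a constant times \<open>(x / a) ^ k\<close>, so the series is dominated
  by a geometric one of ratio \<open>x / \<rho>\<close>.\<close>

lemma summable_newton_coefficients:
  fixes q \<alpha> a x R :: real and f :: "complex \<Rightarrow> complex"
  assumes q: "0 < q" "q < 1" and \<alpha>: "0 < \<alpha>" and a: "0 < a" "a < x"
    and hol: "f holomorphic_on ball 0 R" and R: "x < R"
  shows "summable (\<lambda>k. of_real (x powr (\<alpha> + k) * qpoch_real (a / x) q (\<alpha> + k) / qpoch_real q q (\<alpha> + k))
            * (qdiff q k (\<lambda>j. f (of_real (a * q ^ j))) / of_real (a ^ k)))"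
proof -
  have x: "0 < x" using a by linarith
  define \<rho> where "\<rho> = (x + R) / 2"
  have \<rho>: "x < \<rho>" "\<rho> < R" "a < \<rho>" "0 < \<rho>" using a R by (auto simp: \<rho>_def)
  define e where "e m = (deriv ^^ m) f 0 / fact m" for m
  have e: "(\<lambda>m. e m * y ^ m) sums f y" if "norm y < R" for y
    using holomorphic_power_series[OF hol, of y] that by (simp add: e_def)
  have "summable (\<lambda>m. e m * of_real \<rho> ^ m)"
    using e[of "of_real \<rho>"] \<rho> by (auto simp: sums_iff)
  then have "Bseq (\<lambda>m. e m * of_real \<rho> ^ m)"
    by (intro convergent_imp_Bseq) (meson convergentI summable_LIMSEQ_zero)
  then obtain C where C: "\<And>m. norm (e m * of_real \<rho> ^ m) \<le> C" by (elim BseqE) blast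
  have qd: "norm (qdiff q k (\<lambda>j. f (of_real (a * q ^ j)))) \<le> C * (a / \<rho>) ^ k / (1 - a / \<rho>)" for k
  proof (rule norm_qdiff_power_series_le[OF q])
    fix j
    have "a * q ^ j \<le> a" using a q by (simp add: mult_left_le power_le_one)
    then have "a * q ^ j < R" using a R by linarith
    then have "(\<lambda>m. e m * of_real (a * q ^ j) ^ m) sums f (of_real (a * q ^ j))"
      using a q by (intro e) (simp add: norm_mult norm_power)
    then show "(\<lambda>m. e m * of_real (a ^ m) * of_real (q ^ j) ^ m) sums f (of_real (a * q ^ j))"
      by (simp add: power_mult_distrib mult_ac)
  next
    fix m
    have "norm (e m * of_real (a ^ m)) = norm (e m * of_real \<rho> ^ m) * (a / \<rho>) ^ m"
      using a \<rho> by (simp add: norm_mult norm_power power_divide)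
    also have "\<dots> \<le> C * (a / \<rho>) ^ m"
      using a \<rho> by (intro mult_right_mono C) auto
    finally show "norm (e m * of_real (a ^ m)) \<le> C * (a / \<rho>) ^ m" .
  qed (use a \<rho> in auto)
  define B where "B = x powr \<alpha> / qpoch_inf q q"
  have pos: "0 < qpoch_inf q q" using qpoch_inf_pos[OF q, of q] q by simp
  have c_le: "\<bar>x powr (\<alpha> + k) * qpoch_real (a / x) q (\<alpha> + k) / qpoch_real q q (\<alpha> + k)\<bar> \<le> B * x ^ k" for k :: nat
  proof -
    have nonneg: "0 \<le> qpoch_real (a / x) q (\<alpha> + k) / qpoch_real q q (\<alpha> + k)"
      using qpoch_real_bounds[OF q, of "a / x" "\<alpha> + k"] qpoch_real_bounds[OF q, of q "\<alpha> + k"]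
        qpoch_inf_pos[OF q, of "a / x"] pos a \<alpha> q x
      by (intro divide_nonneg_nonneg) auto
    have "qpoch_real (a / x) q (\<alpha> + k) / qpoch_real q q (\<alpha> + k) \<le> 1 / qpoch_inf q q"
      using qpoch_real_bounds[OF q, of "a / x" "\<alpha> + k"] qpoch_real_bounds[OF q, of q "\<alpha> + k"]
        qpoch_inf_pos[OF q, of "a / x"] pos a \<alpha> q x
      by (intro frac_le) auto
    from mult_left_mono[OF this, of "x powr (\<alpha> + k)"]
    have "x powr (\<alpha> + k) * (qpoch_real (a / x) q (\<alpha> + k) / qpoch_real q q (\<alpha> + k)) \<le> B * x ^ k"
      using x by (simp add: B_def powr_add powr_realpow mult_ac)
    moreover have "0 \<le> x powr (\<alpha> + k) * (qpoch_real (a / x) q (\<alpha> + k) / qpoch_real q q (\<alpha> + k))"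
      using nonneg by (intro mult_nonneg_nonneg) auto
    ultimately show ?thesis by (simp only: times_divide_eq_right abs_of_nonneg)
  qed
  show ?thesis
  proof (rule summable_comparison_test')
    show "summable (\<lambda>k. B * C / (1 - a / \<rho>) * (x / \<rho>) ^ k)"
      using x \<rho> by (intro summable_mult summable_geometric) auto
    fix k :: nat
    let ?c = "x powr (\<alpha> + k) * qpoch_real (a / x) q (\<alpha> + k) / qpoch_real q q (\<alpha> + k)"
    let ?D = "qdiff q k (\<lambda>j. f (of_real (a * q ^ j)))"
    have "norm (of_real ?c * (?D / of_real (a ^ k))) = \<bar>?c\<bar> * (norm ?D / a ^ k)"
      using a unfolding norm_mult norm_divide norm_of_real by simp
    also have "\<dots> \<le> (B * x ^ k) * ((C * (a / \<rho>) ^ k / (1 - a / \<rho>)) / a ^ k)"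
      using a x pos by (intro mult_mono c_le divide_right_mono qd) (auto simp: B_def)
    also have "\<dots> = B * C / (1 - a / \<rho>) * (x / \<rho>) ^ k"
      using a by (simp add: power_divide mult_ac)
    finally show "norm (of_real ?c * (?D / of_real (a ^ k))) \<le> B * C / (1 - a / \<rho>) * (x / \<rho>) ^ k" .
  qed
qed

text \<open>The conditions on \<open>s\<close>, \<open>z\<close>, \<open>u\<close> keep the
  integrand regular on both lattices; those at \<open>a\<close>, with the norm bounds, also make the
  lower parameters admissible. Convergence enters as a premise of the identity because a zero of the
  denominator in \<open>|y| < x\<close> at which the numerator does not vanish makes the series
  diverge: a convergent one would yield a holomorphic quotient there.\<close>

theorem theorem2:
  fixes q \<alpha> a x :: real and b z t r u s :: complex
  assumes "0 < q" "q < 1"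
    and "\<alpha> > 0"
    and "0 < a" "a < x" "x < 1"
    and "Max {cmod (a * t), cmod (a * z), cmod (a * r * u)} < 1"
    and "\<And>n::nat. x * s * q ^ n \<noteq> 1" "\<And>n::nat. x * z * q ^ n \<noteq> 1" "\<And>n::nat. x * u * q ^ n \<noteq> 1"
    and "\<And>n::nat. a * s * q ^ n \<noteq> 1" "\<And>n::nat. a * u * q ^ n \<noteq> 1"
    and "\<And>n::nat. a * b * z * q ^ n \<noteq> 1"
  shows
    "let T = (\<lambda>k::nat.
           complex_of_real (x powr (\<alpha> + k) * qpoch_real (a / x) q (\<alpha> + k)
                              / (a ^ k * qpoch_real q q (\<alpha> + k)))
           * qhyp [complex_of_real (q powi (- int k)), a * s, a * z, a * u]
                  [a * b * z, a * t, a * r * u] q q)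
     in (cmod (x * s) < 1 \<and> cmod (x * z) < 1 \<and> cmod (x * u) < 1 \<longrightarrow> summable T) \<and>
        (summable T \<longrightarrow>
           frac_qintegral q a \<alpha>
             (\<lambda>y. qpochs_inf [b * y * z, y * t, y * r * u] q / qpochs_inf [y * s, y * z, y * u] q) x
           = complex_of_real ((1 - q) powr \<alpha>)
             * qpochs_inf [a * b * z, a * t, a * r * u] q / qpochs_inf [a * s, a * z, a * u] q
             * (\<Sum>k. T k))"
proof -
  note q = assms(1,2) and \<alpha> = assms(3) and a = assms(4,5)
  have x: "0 < x" using a by linarith
  define G where "G y = qpochs_inf [y * s, y * z, y * u] q" for y :: complex
  define H where "H y = qpochs_inf [b * y * z, y * t, y * r * u] q" for y :: complex
  define c where "c k = x powr (\<alpha> + k) * qpoch_real (a / x) q (\<alpha> + k) / qpoch_real q q (\<alpha> + k)" for k :: nat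
  define d where "d k = qdiff q k (\<lambda>j. H (of_real (a * q ^ j)) / G (of_real (a * q ^ j))) / of_real (a ^ k)" for k
  define T where "T k = complex_of_real (x powr (\<alpha> + k) * qpoch_real (a / x) q (\<alpha> + k)
                              / (a ^ k * qpoch_real q q (\<alpha> + k)))
           * qhyp [complex_of_real (q powi (- int k)), a * s, a * z, a * u]
                  [a * b * z, a * t, a * r * u] q q" for k :: nat
  have ball: "cmod (a * t) < 1" "cmod (a * z) < 1" "cmod (a * r * u) < 1"
    using assms(7) by auto
  have az: "a * z * q ^ n \<noteq> 1" and at: "a * t * q ^ n \<noteq> 1" and aru: "a * r * u * q ^ n \<noteq> 1" for n
    using norm_less_1_mult_power_neq_1[OF q ball(1), of n] norm_less_1_mult_power_neq_1[OF q ball(2), of n]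
      norm_less_1_mult_power_neq_1[OF q ball(3), of n] by auto
  have hol: "G holomorphic_on UNIV" "H holomorphic_on UNIV"
    unfolding G_def[abs_def] H_def[abs_def] qpochs_inf_def using q by (auto intro!: holomorphic_intros)
  have shift: "of_real (y * q ^ j) * w * of_real q ^ n = of_real y * w * of_real q ^ (j + n)"
    for y :: real and w :: complex and j n
    by (simp add: power_add mult_ac)
  have Ga: "G (of_real (a * q ^ j)) \<noteq> 0" for j
    unfolding G_def qpochs_inf_def using assms(11,12) az
    by (auto simp del: of_real_mult intro!: qpoch_inf_nonzero[OF q] simp: shift)
  have Gx: "G (of_real (x * q ^ j)) \<noteq> 0" for j
    unfolding G_def qpochs_inf_def using assms(8-10)
    by (auto simp del: of_real_mult intro!: qpoch_inf_nonzero[OF q] simp: shift)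
  \<comment> \<open>Splitting the first \<open>j\<close> factors off each infinite product yields
    exactly the parameters of the hypergeometric series.\<close>
  have nodes: "H (of_real (a * q ^ j)) / G (of_real (a * q ^ j)) = H (of_real a) / G (of_real a) *
      (qpochs [a * s, a * z, a * u] q j / qpochs [a * b * z, a * t, a * r * u] q j)" for j
  proof -
    have split: "qpoch_inf w q = qpoch w q j * qpoch_inf w' q" if "w' = w * of_real q ^ j" for w w' :: complex
      unfolding that by (rule qpoch_inf_split[OF q])
    have splits: "qpoch_inf (a * s) q = qpoch (a * s) q j * qpoch_inf (of_real (a * q ^ j) * s) q"
      "qpoch_inf (a * z) q = qpoch (a * z) q j * qpoch_inf (of_real (a * q ^ j) * z) q"
      "qpoch_inf (a * u) q = qpoch (a * u) q j * qpoch_inf (of_real (a * q ^ j) * u) q"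
      "qpoch_inf (a * b * z) q = qpoch (a * b * z) q j * qpoch_inf (b * of_real (a * q ^ j) * z) q"
      "qpoch_inf (a * t) q = qpoch (a * t) q j * qpoch_inf (of_real (a * q ^ j) * t) q"
      "qpoch_inf (a * r * u) q = qpoch (a * r * u) q j * qpoch_inf (of_real (a * q ^ j) * r * u) q"
      by (rule split, simp add: mult_ac)+
    have nz: "qpoch (a * s) q j \<noteq> 0" "qpoch (a * z) q j \<noteq> 0" "qpoch (a * u) q j \<noteq> 0"
      "qpoch (a * b * z) q j \<noteq> 0" "qpoch (a * t) q j \<noteq> 0" "qpoch (a * r * u) q j \<noteq> 0"
      using assms(11-13) az at aru by (auto intro!: qpoch_nonzero[OF q])
    have Geq: "G (of_real a) = qpochs [a * s, a * z, a * u] q j * G (of_real (a * q ^ j))"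
      unfolding G_def qpochs_inf_def qpochs_def list.map splits by simp
    have Heq: "H (of_real a) = qpochs [a * b * z, a * t, a * r * u] q j * H (of_real (a * q ^ j))"
      unfolding H_def qpochs_inf_def qpochs_def list.map mult.commute[of b "of_real a"] splits by simp
    have "qpochs [a * s, a * z, a * u] q j \<noteq> 0" "qpochs [a * b * z, a * t, a * r * u] q j \<noteq> 0"
      using nz by (auto simp: qpochs_def)
    then show ?thesis unfolding Geq Heq by (simp add: field_simps)
  qed
  define f0 where "f0 = H (of_real a) / G (of_real a)"
  have "H (of_real a) \<noteq> 0"
    unfolding H_def qpochs_inf_def using assms(13) at aru
    by (auto intro!: qpoch_inf_nonzero[OF q] simp: mult.commute[of b])
  then have f0: "f0 \<noteq> 0" using Ga[of 0] by (simp add: f0_def)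
  have T: "of_real (c k) * d k = f0 * T k" for k
  proof -
    have "qdiff q k (\<lambda>j. H (of_real (a * q ^ j)) / G (of_real (a * q ^ j)))
        = f0 * qhyp [complex_of_real (q powi (- int k)), a * s, a * z, a * u]
                  [a * b * z, a * t, a * r * u] q q"
      using qhyp_eq_qdiff[OF q, of "[a * s, a * z, a * u]" "[a * b * z, a * t, a * r * u]"
        "\<lambda>j. H (of_real (a * q ^ j)) / G (of_real (a * q ^ j))" k] nodes
      by (simp add: f0_def)
    then show ?thesis by (simp add: d_def T_def c_def mult_ac)
  qed
  \<comment> \<open>The constant \<open>f0\<close> is nonzero, so summability passes in both
    directions.\<close>
  have summable_iff: "summable T \<longleftrightarrow> summable (\<lambda>k. of_real (c k) * d k)"
    unfolding T using f0 by (simp add: summable_cmult_iff)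
  have "summable T" if "cmod (x * s) < 1" "cmod (x * z) < 1" "cmod (x * u) < 1"
  proof -
    define m where "m = Max {cmod s, cmod z, cmod u}"
    have m: "cmod s \<le> m" "cmod z \<le> m" "cmod u \<le> m" "0 \<le> m" "x * m < 1"
    proof -
      show le: "cmod s \<le> m" "cmod z \<le> m" "cmod u \<le> m" by (auto simp: m_def)
      show "0 \<le> m" using le(1) norm_ge_zero[of s] by linarith
      have "m \<in> {cmod s, cmod z, cmod u}" unfolding m_def by (rule Max_in) auto
      then show "x * m < 1" using that x by (auto simp: norm_mult)
    qed
    \<comment> \<open>The mediant of \<open>x / 1\<close> and \<open>1 / m\<close>: it exceeds
      \<open>x\<close> and satisfies \<open>R * m < 1\<close>, also for \<open>m = 0\<close>, so
      \<open>G\<close> has no zero in the disc of radius \<open>R\<close>.\<close>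
    define R where "R = (1 + x) / (1 + m)"
    have R: "x < R" "R * m < 1" using m x by (auto simp: R_def field_simps)
    have ne: "y * w * of_real q ^ n \<noteq> 1" if "y \<in> ball 0 R" "cmod w \<le> m" for y w :: complex and n
    proof (rule norm_less_1_mult_power_neq_1[OF q])
      have "cmod (y * w) \<le> R * m"
        unfolding norm_mult using that R x by (intro mult_mono) auto
      then show "cmod (y * w) < 1" using R by linarith
    qed
    have Gne: "G y \<noteq> 0" if "y \<in> ball 0 R" for y
      unfolding G_def qpochs_inf_def using ne[OF that] m
      by (auto intro!: qpoch_inf_nonzero[OF q])
    have "(\<lambda>y. H y / G y) holomorphic_on ball 0 R"
      using hol Gne by (intro holomorphic_on_divide) (auto intro: holomorphic_on_subset)
    from summable_newton_coefficients[OF q \<alpha> a this R(1)]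
    show ?thesis unfolding summable_iff c_def d_def .
  qed
  moreover have "frac_qintegral q a \<alpha> (\<lambda>y. H (of_real y) / G (of_real y)) x
      = complex_of_real ((1 - q) powr \<alpha>) * H (of_real a) / G (of_real a) * (\<Sum>k. T k)" if "summable T"
  proof -
    have "frac_qintegral q a \<alpha> (\<lambda>y. H (of_real y) / G (of_real y)) x
      = of_real ((1 - q) powr \<alpha>) * (\<Sum>k. of_real (c k) * d k)"
      using that unfolding summable_iff c_def d_def
      by (intro frac_qintegral_newton_series q \<alpha> a hol Ga Gx)
    also have "(\<Sum>k. of_real (c k) * d k) = f0 * (\<Sum>k. T k)"
      unfolding T by (rule suminf_mult[OF that])
    finally show ?thesis by (simp add: f0_def)
  qed
  ultimately show ?thesis
    unfolding Let_def T_def[abs_def, symmetric] G_def H_def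
    by (simp add: mult_ac)
qed

end
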